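(* Let $K$ be an algebraically closed field of characteristic $2$. Writing $MT(X_l)$ for the toral rank of the classical type simple Lie $2$-algebra $\overline{\mathfrak g(X_l,K)}$, one has: (1) $MT(A_n)=n$ if $2\nmid (n+1)$, $n>1$; (2) $MT(A_n)=n-1$ if $2\mid (n+1)$, $n>1$; (3) $MT(D_n)=n-1$ if $n$ is odd, $n\ge 3$; (4) $MT(D_n)=n-2$ if $n$ is even, $n\ge 3$; (5) $MT(\mathfrak g_2)=2$; (6) $MT(\mathfrak e_6)=6$; (7) $MT(\mathfrak e_7)=6$; (8) $MT(\mathfrak e_8)=8$.
   Context: All Lie algebras are finite-dimensional over $K$. Lie $2$-algebra: a Lie algebra $\mathfrak g$ with a map $[2]:\mathfrak g\to\mathfrak g$, $a\mapsto a^{[2]}$, such that $(a+b)^{[2]}=a^{[2]}+b^{[2]}+[a,b]$, $(\mu a)^{[2]}=\mu^2a^{[2]}$ and $\mathrm{ad}(a^{[2]})=(\mathrm{ad}\,a)^2$ for all $a,b\in\mathfrak g$, $\mu\in K$. If the center of $\mathfrak g$ is zero, such a map is unique if it exists. A simple Lie $2$-algebra is a Lie $2$-algebra whose underlying Lie algebra is simple. Torus: a subalgebra $\mathfrak t$ of $(\mathfrak g,[2])$ on which the map $[2]$ is invertible. The toral rank of $(\mathfrak g,[2])$ is $MT(\mathfrak g)=\max\{\dim_K\mathfrak t : \mathfrak t \text{ a torus in }\mathfrak g\}$. Classical Lie algebra of type $X_l$: for an irreducible root system of type $X_l$, let $\mathfrak g(X_l,K)$ be the Chevalley algebra over $K$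 (the $\mathbb Z$-span of a Chevalley basis of the complex simple Lie algebra of type $X_l$, tensored with $K$). The classical Lie algebra of type $X_l$ is $\overline{\mathfrak g(X_l,K)}=\mathfrak g(X_l,K)/\mathfrak z(\mathfrak g(X_l,K))$, where $\mathfrak z$ denotes the center. A classical type simple Lie $2$-algebra is a simple Lie $2$-algebra of this form. By convention $D_3$ is the root system $A_3$. *)

theory Defs
  imports "HOL-Analysis.Analysis" "HOL-Computational_Algebra.Computational_Algebra"
begin

section \<open>Lie algebras and Lie 2-algebras\<close>

text \<open>Lie algebras are finite-dimensional throughout.\<close>

locale lie_algebra = vector_space scale
  for scale :: "'k::field \<Rightarrow> 'g::ab_group_add \<Rightarrow> 'g" +
  fixes bracket :: "'g \<Rightarrow> 'g \<Rightarrow> 'g"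
  assumes finite_dimensional: "\<exists>B. finite B \<and> span B = UNIV"
    and bracket_add_left: "bracket (x + y) z = bracket x z + bracket y z"
    and bracket_add_right: "bracket x (y + z) = bracket x y + bracket x z"
    and bracket_scale_left: "bracket (scale c x) y = scale c (bracket x y)"
    and bracket_scale_right: "bracket x (scale c y) = scale c (bracket x y)"
    and bracket_self: "bracket x x = 0"
    and jacobi: "bracket x (bracket y z) + bracket y (bracket z x) + bracket z (bracket x y) = 0"
begin

definition subalgebra :: "'g set \<Rightarrow> bool" where
  "subalgebra S \<longleftrightarrow> subspace S \<and> (\<forall>x\<in>S. \<forall>y\<in>S. bracket x y \<in> S)"

definition lie_ideal :: "'g set \<Rightarrow> bool" where
  "lie_ideal I \<longleftrightarrow> subspace I \<and> (\<forall>x. \<forall>y\<in>I. bracket x y \<in> I)"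

definition centre :: "'g set" where
  "centre = {z. \<forall>x. bracket z x = 0}"

end

locale simple_lie_algebra = lie_algebra scale bracket
  for scale :: "'k::field \<Rightarrow> 'g::ab_group_add \<Rightarrow> 'g" and bracket +
  assumes non_abelian: "\<exists>x y. bracket x y \<noteq> 0"
    and only_trivial_ideals: "lie_ideal I \<Longrightarrow> I = {0} \<or> I = UNIV"

text \<open>The axioms are those of a restricted Lie algebra only when the field has characteristic 2,
  which is assumed where the locale is used.\<close>

locale lie2_algebra = lie_algebra scale bracket
  for scale :: "'k::field \<Rightarrow> 'g::ab_group_add \<Rightarrow> 'g" and bracket +
  fixes sq :: "'g \<Rightarrow> 'g"
  assumes sq_add: "sq (a + b) = sq a + sq b + bracket a b"
    and sq_scale: "sq (scale c a) = scale (c\<^sup>2) (sq a)"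
    and ad_sq: "bracket (sq a) b = bracket a (bracket a b)"
begin

definition torus :: "'g set \<Rightarrow> bool" where
  "torus T \<longleftrightarrow> subalgebra T \<and> bij_betw sq T T"

text \<open>The set of dimensions is nonempty (\<open>{0}\<close> is a torus) and bounded by the dimension of the
  algebra, so \<open>Max\<close> is meaningful.\<close>

definition toral_rank :: nat where
  "toral_rank = Max {dim T | T. torus T}"

end

locale simple_lie2_algebra = simple_lie_algebra scale bracket + lie2_algebra scale bracket sq
  for scale :: "'k::field \<Rightarrow> 'g::ab_group_add \<Rightarrow> 'g" and bracket sq


section \<open>Irreducible root systems and their types\<close>

definition coroot :: "'r::euclidean_space \<Rightarrow> 'r" where
  "coroot a = (2 / (a \<bullet> a)) *\<^sub>R a"

locale irreducible_root_system =
  fixes \<Phi> :: "'r::euclidean_space set"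
  assumes finite_roots: "finite \<Phi>"
    and span_roots: "span \<Phi> = UNIV"
    and zero_not_root: "0 \<notin> \<Phi>"
    and reflection: "\<lbrakk>a \<in> \<Phi>; b \<in> \<Phi>\<rbrakk> \<Longrightarrow> b - (b \<bullet> coroot a) *\<^sub>R a \<in> \<Phi>"
    and integrality: "\<lbrakk>a \<in> \<Phi>; b \<in> \<Phi>\<rbrakk> \<Longrightarrow> b \<bullet> coroot a \<in> \<int>"
    and reduced: "\<lbrakk>a \<in> \<Phi>; c *\<^sub>R a \<in> \<Phi>\<rbrakk> \<Longrightarrow> c = 1 \<or> c = -1"
    and irreducible: "\<lbrakk>\<Phi> = S \<union> T; \<forall>a\<in>S. \<forall>b\<in>T. a \<bullet> b = 0\<rbrakk> \<Longrightarrow> S = {} \<or> T = {}"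

datatype root_type =
    Type_A nat | Type_B nat | Type_C nat | Type_D nat
  | Type_E6 | Type_E7 | Type_E8 | Type_F4 | Type_G2

fun rank_of :: "root_type \<Rightarrow> nat" where
  "rank_of (Type_A l) = l"
| "rank_of (Type_B l) = l"
| "rank_of (Type_C l) = l"
| "rank_of (Type_D l) = l"
| "rank_of Type_E6 = 6"
| "rank_of Type_E7 = 7"
| "rank_of Type_E8 = 8"
| "rank_of Type_F4 = 4"
| "rank_of Type_G2 = 2"

text \<open>Edges \<open>i < j\<close> of the Dynkin diagram, with the vertices \<open>1, \<dots>, l\<close> in Bourbaki's numbering.
  For \<open>Type_D 3\<close> the edges are 1--2 and 1--3, so that \<open>D\<^sub>3\<close> is the root system \<open>A\<^sub>3\<close>.\<close>

definition e_edge :: "nat \<Rightarrow> nat \<Rightarrow> bool" where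
  "e_edge i j \<longleftrightarrow> i = 1 \<and> j = 3 \<or> i = 2 \<and> j = 4 \<or> 3 \<le> i \<and> j = i + 1"

fun dynkin_edge :: "root_type \<Rightarrow> nat \<Rightarrow> nat \<Rightarrow> bool" where
  "dynkin_edge (Type_A l) i j \<longleftrightarrow> j = i + 1"
| "dynkin_edge (Type_B l) i j \<longleftrightarrow> j = i + 1"
| "dynkin_edge (Type_C l) i j \<longleftrightarrow> j = i + 1"
| "dynkin_edge (Type_D l) i j \<longleftrightarrow> j = i + 1 \<and> j < l \<or> j = i + 2 \<and> j = l"
| "dynkin_edge Type_E6 i j \<longleftrightarrow> e_edge i j"
| "dynkin_edge Type_E7 i j \<longleftrightarrow> e_edge i j"
| "dynkin_edge Type_E8 i j \<longleftrightarrow> e_edge i j"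
| "dynkin_edge Type_F4 i j \<longleftrightarrow> j = i + 1"
| "dynkin_edge Type_G2 i j \<longleftrightarrow> j = i + 1"

text \<open>The entry at an ordered pair of adjacent vertices is the negative of the following number;
  the convention is \<open>cartan_matrix X i j = 2 (\<alpha>\<^sub>i, \<alpha>\<^sub>j) / (\<alpha>\<^sub>j, \<alpha>\<^sub>j)\<close>.\<close>

fun cartan_mult :: "root_type \<Rightarrow> nat \<Rightarrow> nat \<Rightarrow> int" where
  "cartan_mult (Type_B l) i j = (if i = l - 1 \<and> j = l then 2 else 1)"
| "cartan_mult (Type_C l) i j = (if i = l \<and> j = l - 1 then 2 else 1)"
| "cartan_mult Type_F4 i j = (if i = 2 \<and> j = 3 then 2 else 1)"
| "cartan_mult Type_G2 i j = (if i = 2 \<and> j = 1 then 3 else 1)"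
| "cartan_mult _ i j = 1"

definition cartan_matrix :: "root_type \<Rightarrow> nat \<Rightarrow> nat \<Rightarrow> int" where
  "cartan_matrix X i j =
     (if i = j then 2
      else if dynkin_edge X i j \<or> dynkin_edge X j i then - cartan_mult X i j
      else 0)"

locale based_root_system = irreducible_root_system \<Phi>
  for \<Phi> :: "'r::euclidean_space set" +
  fixes X :: root_type and \<alpha> :: "nat \<Rightarrow> 'r"
  assumes simple_roots: "\<alpha> ` {1..rank_of X} \<subseteq> \<Phi>"
    and simple_inj: "inj_on \<alpha> {1..rank_of X}"
    and simple_independent: "independent (\<alpha> ` {1..rank_of X})"
    and base: "b \<in> \<Phi> \<Longrightarrow> \<exists>m::nat \<Rightarrow> nat.
          b = (\<Sum>i = 1..rank_of X. real (m i) *\<^sub>R \<alpha> i) \<or>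
          b = - (\<Sum>i = 1..rank_of X. real (m i) *\<^sub>R \<alpha> i)"
    and cartan: "\<lbrakk>i \<in> {1..rank_of X}; j \<in> {1..rank_of X}\<rbrakk> \<Longrightarrow>
          \<alpha> i \<bullet> coroot (\<alpha> j) = of_int (cartan_matrix X i j)"


section \<open>Chevalley bases, Chevalley algebras and classical Lie algebras\<close>

text \<open>A Chevalley basis \<open>{e\<^sub>a | a \<in> \<Phi>} \<union> {h\<^sub>i | 1 \<le> i \<le> l}\<close> of the complex simple Lie algebra with
  root system \<open>\<Phi>\<close>. The last two relations say \<open>[e\<^sub>a, e\<^sub>b] = \<plusminus>(r + 1) e\<^bsub>a+b\<^esub>\<close>, with \<open>r\<close> the greatest
  integer such that \<open>b - r a\<close> is a root, respectively \<open>[e\<^sub>a, e\<^sub>b] = 0\<close>. The coefficients \<open>m\<close> in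
  \<open>e_opposite\<close> are determined on \<open>{1..l}\<close> because the simple coroots are linearly independent.
  The span of the \<open>h\<^sub>i\<close> is a Cartan subalgebra with root spaces spanned by the \<open>e\<^sub>a\<close>.\<close>

locale chevalley_basis =
  based_root_system \<Phi> X \<alpha> + L: simple_lie_algebra scaleL bracketL
  for \<Phi> :: "'r::euclidean_space set" and X \<alpha>
    and scaleL :: "complex \<Rightarrow> 'l::ab_group_add \<Rightarrow> 'l" and bracketL +
  fixes e :: "'r \<Rightarrow> 'l" and h :: "nat \<Rightarrow> 'l"
  assumes basis_inj: "inj_on (case_sum e h) (\<Phi> <+> {1..rank_of X})"
    and basis_independent: "L.independent (case_sum e h ` (\<Phi> <+> {1..rank_of X}))"
    and basis_span: "L.span (case_sum e h ` (\<Phi> <+> {1..rank_of X})) = UNIV"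
    and h_h: "\<lbrakk>i \<in> {1..rank_of X}; j \<in> {1..rank_of X}\<rbrakk> \<Longrightarrow> bracketL (h i) (h j) = 0"
    and h_e: "\<lbrakk>i \<in> {1..rank_of X}; b \<in> \<Phi>\<rbrakk> \<Longrightarrow>
          bracketL (h i) (e b) = scaleL (of_real (b \<bullet> coroot (\<alpha> i))) (e b)"
    and e_opposite: "a \<in> \<Phi> \<Longrightarrow> \<exists>m::nat \<Rightarrow> int.
          coroot a = (\<Sum>i = 1..rank_of X. of_int (m i) *\<^sub>R coroot (\<alpha> i)) \<and>
          bracketL (e a) (e (- a)) = (\<Sum>i = 1..rank_of X. scaleL (of_int (m i)) (h i))"
    and e_e: "\<lbrakk>a \<in> \<Phi>; b \<in> \<Phi>; a + b \<in> \<Phi>\<rbrakk> \<Longrightarrow> \<exists>s\<in>{1, -1}.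
          bracketL (e a) (e b)
            = scaleL (s * of_nat (Max {r::nat. b - real r *\<^sub>R a \<in> \<Phi>} + 1)) (e (a + b))"
    and e_e_zero: "\<lbrakk>a \<in> \<Phi>; b \<in> \<Phi>; a + b \<notin> \<Phi>; a + b \<noteq> 0\<rbrakk> \<Longrightarrow> bracketL (e a) (e b) = 0"
begin

definition z_form :: "'l set" where
  "z_form = {\<Sum>x \<in> \<Phi> <+> {1..rank_of X}. scaleL (of_int (c x)) (case_sum e h x) |
     c :: 'r + nat \<Rightarrow> int. True}"

end

text \<open>The tensor product of the \<open>\<int>\<close>-form with \<open>K\<close>, up to isomorphism: a Lie algebra \<open>G\<close> over \<open>K\<close>
  together with the map \<open>\<tau>\<close> playing the role of \<open>x \<mapsto> x \<otimes> 1\<close>. As the \<open>\<int>\<close>-form is free on the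
  Chevalley basis, this means that \<open>\<tau>\<close> is a homomorphism of Lie rings taking that basis to a
  \<open>K\<close>-basis of \<open>G\<close>. The values of \<open>\<tau>\<close> outside the \<open>\<int>\<close>-form are irrelevant.\<close>

locale chevalley_algebra =
  chevalley_basis \<Phi> X \<alpha> scaleL bracketL e h + G: lie_algebra scaleG bracketG
  for \<Phi> :: "'r::euclidean_space set" and X \<alpha>
    and scaleL :: "complex \<Rightarrow> 'l::ab_group_add \<Rightarrow> 'l" and bracketL e h
    and scaleG :: "'k::field \<Rightarrow> 'c::ab_group_add \<Rightarrow> 'c" and bracketG +
  fixes \<tau> :: "'l \<Rightarrow> 'c"
  assumes tensor_add: "\<lbrakk>x \<in> z_form; y \<in> z_form\<rbrakk> \<Longrightarrow> \<tau> (x + y) = \<tau> x + \<tau> y"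
    and tensor_bracket: "\<lbrakk>x \<in> z_form; y \<in> z_form\<rbrakk> \<Longrightarrow> \<tau> (bracketL x y) = bracketG (\<tau> x) (\<tau> y)"
    and tensor_inj: "inj_on (\<tau> \<circ> case_sum e h) (\<Phi> <+> {1..rank_of X})"
    and tensor_independent: "G.independent ((\<tau> \<circ> case_sum e h) ` (\<Phi> <+> {1..rank_of X}))"
    and tensor_span: "G.span ((\<tau> \<circ> case_sum e h) ` (\<Phi> <+> {1..rank_of X})) = UNIV"

text \<open>The quotient of the Chevalley algebra by its centre, up to isomorphism: a Lie algebra with a
  surjective homomorphism \<open>\<pi>\<close> from the Chevalley algebra whose kernel is the centre.\<close>

locale classical_lie_algebra =
  chevalley_algebra \<Phi> X \<alpha> scaleL bracketL e h scaleG bracketG \<tau> + lie_algebra scale bracket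
  for \<Phi> :: "'r::euclidean_space set" and X \<alpha>
    and scaleL :: "complex \<Rightarrow> 'l::ab_group_add \<Rightarrow> 'l" and bracketL e h
    and scaleG :: "'k::field \<Rightarrow> 'c::ab_group_add \<Rightarrow> 'c" and bracketG \<tau>
    and scale :: "'k \<Rightarrow> 'g::ab_group_add \<Rightarrow> 'g" and bracket +
  fixes \<pi> :: "'c \<Rightarrow> 'g"
  assumes quotient_linear: "Vector_Spaces.linear scaleG scale \<pi>"
    and quotient_bracket: "\<pi> (bracketG x y) = bracket (\<pi> x) (\<pi> y)"
    and quotient_surj: "surj \<pi>"
    and quotient_kernel: "{x. \<pi> x = 0} = G.centre"

locale classical_simple_lie2_algebra =
  classical_lie_algebra \<Phi> X \<alpha> scaleL bracketL e h scaleG bracketG \<tau> scale bracket \<pi> +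
  simple_lie2_algebra scale bracket sq
  for \<Phi> :: "'r::euclidean_space set" and X \<alpha>
    and scaleL :: "complex \<Rightarrow> 'l::ab_group_add \<Rightarrow> 'l" and bracketL e h
    and scaleG :: "'k::field \<Rightarrow> 'c::ab_group_add \<Rightarrow> 'c" and bracketG \<tau>
    and scale :: "'k \<Rightarrow> 'g::ab_group_add \<Rightarrow> 'g" and bracket \<pi> sq

end

theory Submission
  imports Defs
begin

text \<open>
  Two bounds on the toral rank are needed, and both come from the image \<open>C\<close> of the diagonal
  subalgebra spanned by the \<open>h i\<close>. The claim is that \<open>MT = dim C\<close>, and that \<open>dim C\<close> is the rank
  modulo 2 of the Cartan matrix.

  Lower bound: \<open>C\<close> is a torus. An integer and its square have the same parity, so the image of
  \<open>h i\<close> satisfies \<open>(ad H)^2 = ad H\<close>; the centre is zero, hence \<open>H\<close> is fixed by the 2-map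
  (\<open>sq_H\<close>, \<open>torus_cartan\<close>).

  Upper bound: for a torus \<open>T\<close> and every element \<open>a\<close> of the Lie algebra, \<open>dim T\<close> is at most the
  dimension of the centralizer of \<open>a\<close> (\<open>torus_dim_le_centralizer\<close>). The reason is
  semicontinuity along a line. A torus is spanned by the iterates under the 2-map of one element
  \<open>x\<close> (\<open>torus_generic_element\<close>). The iterates of any element \<open>y\<close> lie in the centralizer of
  \<open>y\<close>. On the line joining \<open>a\<close> and \<open>x\<close>, a generic \<open>y\<close> has at least as many independent iterates as
  \<open>x\<close> and a centralizer that is no larger than that of \<open>a\<close>. The bound is then applied to an
  element \<open>a\<close> of \<open>C\<close> on which no root vanishes: its centralizer is \<open>C\<close>.

  Such an \<open>a\<close> exists because no root vanishes identically on \<open>C\<close> modulo 2, that is, because each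
  root has an odd pairing with some simple coroot. In the simply laced types this follows from a
  comparison of lengths (\<open>odd_pairing_simply_laced\<close>), in type \<open>G\<^sub>2\<close> from another one together
  with the invertibility of the Cartan matrix modulo 2. In type \<open>A\<^sub>1\<close> all pairings are even, whence the condition \<open>n > 1\<close>.

  Since the centre of the quotient is zero, a combination of the \<open>h i\<close> vanishes in \<open>C\<close> exactly if all
  simple roots vanish on it. The dimension of \<open>C\<close> is therefore \<open>l\<close> minus the nullity of the
  Cartan matrix modulo 2, and this nullity is 1 for \<open>A\<^sub>n\<close> and \<open>D\<^sub>n\<close> with \<open>n\<close> odd and for
  \<open>E\<^sub>7\<close>, 2 for \<open>D\<^sub>n\<close> with \<open>n\<close> even, and 0 for \<open>A\<^sub>n\<close> with \<open>n\<close> even and for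
  \<open>E\<^sub>6\<close>, \<open>E\<^sub>8\<close> and \<open>G\<^sub>2\<close>.
\<close>

section \<open>Independent families and polynomial curves\<close>

locale coordinate_space = vector_space scale
  for scale :: "'a::field \<Rightarrow> 'b::ab_group_add \<Rightarrow> 'b" (infixr \<open>\<odot>\<close> 75)
begin

text \<open>Families rather than sets: a polynomial curve of vectors may let two members of a family
  collide at some parameter, and such a parameter has to count as one of dependence.\<close>

definition indep_family :: "'i set \<Rightarrow> ('i \<Rightarrow> 'b) \<Rightarrow> bool" where
  "indep_family I v \<longleftrightarrow> (\<forall>c. (\<Sum>i\<in>I. c i \<odot> v i) = 0 \<longrightarrow> (\<forall>i\<in>I. c i = 0))"

lemma indep_familyD:
  "indep_family I v \<Longrightarrow> (\<Sum>i\<in>I. c i \<odot> v i) = 0 \<Longrightarrow> i \<in> I \<Longrightarrow> c i = 0"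
  by (auto simp: indep_family_def)

lemma indep_family_cong: "(\<And>i. i \<in> I \<Longrightarrow> v i = w i) \<Longrightarrow> indep_family I v = indep_family I w"
  by (auto simp: indep_family_def)

lemma indep_family_empty [simp]: "indep_family {} v"
  by (simp add: indep_family_def)

lemma indep_family_iff:
  assumes "finite I"
  shows "indep_family I v \<longleftrightarrow> inj_on v I \<and> independent (v ` I)"
proof
  assume ind: "indep_family I v"
  have inj: "inj_on v I"
  proof (rule inj_onI, rule ccontr)
    fix i j assume ij: "i \<in> I" "j \<in> I" "v i = v j" "i \<noteq> j"
    let ?c = "\<lambda>k. if k = i then 1 else if k = j then - 1 else 0"
    have "(\<Sum>k\<in>I. ?c k \<odot> v k) = (\<Sum>k\<in>{i, j}. ?c k \<odot> v k)"
      using ij assms by (intro sum.mono_neutral_right) auto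
    also have "\<dots> = 0" using ij by simp
    finally show False using indep_familyD[OF ind, of ?c i] ij by simp
  qed
  moreover have "independent (v ` I)"
  proof (rule independent_if_scalars_zero)
    show "finite (v ` I)" using assms by simp
    fix f x assume f: "(\<Sum>x\<in>v ` I. f x \<odot> x) = 0" and x: "x \<in> v ` I"
    have "(\<Sum>i\<in>I. f (v i) \<odot> v i) = 0" using f inj by (simp add: sum.reindex)
    then show "f x = 0" using indep_familyD[OF ind, of "f \<circ> v"] x by auto
  qed
  ultimately show "inj_on v I \<and> independent (v ` I)" ..
next
  assume *: "inj_on v I \<and> independent (v ` I)"
  show "indep_family I v"
    unfolding indep_family_def
  proof (intro allI impI ballI)
    fix c i assume c: "(\<Sum>i\<in>I. c i \<odot> v i) = 0" and i: "i \<in> I"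
    have "(\<Sum>x\<in>v ` I. c (the_inv_into I v x) \<odot> x) = (\<Sum>i\<in>I. c i \<odot> v i)"
      using * by (simp add: sum.reindex the_inv_into_f_f)
    then have "c (the_inv_into I v (v i)) = 0"
      using independentD[of "v ` I" "v ` I" "\<lambda>x. c (the_inv_into I v x)"] * c i assms by auto
    then show "c i = 0" using * i by (simp add: the_inv_into_f_f)
  qed
qed

lemma indep_family_insert:
  assumes "finite I" "j \<notin> I"
  shows "indep_family (insert j I) v \<longleftrightarrow> indep_family I v \<and> v j \<notin> span (v ` I)"
  using assms by (auto simp: indep_family_iff independent_insert span_base image_iff)

lemma span_image_sum:
  assumes "finite I" "x \<in> span (v ` I)"
  obtains c where "x = (\<Sum>i\<in>I. c i \<odot> v i)"
proof -
  have "x \<in> span (v ` I) \<Longrightarrow> \<exists>c. x = (\<Sum>i\<in>I. c i \<odot> v i)"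
  proof (induction rule: span_induct_alt)
    case base
    show ?case by (rule exI[of _ "\<lambda>_. 0"]) simp
  next
    case (step a y z)
    from step(1) obtain j where j: "j \<in> I" "y = v j" by auto
    from step(2) obtain c where c: "z = (\<Sum>i\<in>I. c i \<odot> v i)" by auto
    have "(\<Sum>i\<in>I. (if i = j then a else 0) \<odot> v i) = (\<Sum>i\<in>I. if i = j then a \<odot> v i else 0)"
      by (rule sum.cong) auto
    also have "\<dots> = a \<odot> y" using j assms(1) by simp
    finally show ?case
      by (intro exI[of _ "\<lambda>i. (if i = j then a else 0) + c i"])
        (simp add: c scale_left_distrib sum.distrib)
  qed
  then show ?thesis using assms(2) that by blast
qed

text \<open>The form \<open>v + t f(t)\<close> is Horner's scheme. Closure under the 2-map of a Lie 2-algebra then needs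
  only the value of the 2-map on a sum of two vectors, not on a sum of arbitrarily many.\<close>

inductive polynomial_curve :: "('a \<Rightarrow> 'b) \<Rightarrow> bool" where
  const: "polynomial_curve (\<lambda>t. v)"
| horner: "polynomial_curve f \<Longrightarrow> polynomial_curve (\<lambda>t. v + t \<odot> f t)"

lemma polynomial_curve_add:
  assumes "polynomial_curve f" "polynomial_curve g"
  shows "polynomial_curve (\<lambda>t. f t + g t)"
  using assms
proof (induction arbitrary: g)
  case (const v)
  from const.prems show ?case
  proof cases
    case (const w)
    then show ?thesis using polynomial_curve.const[of "v + w"] by simp
  next
    case (horner g' w)
    then show ?thesis using polynomial_curve.horner[of g' "v + w"] by (simp add: add.assoc)
  qed
next
  case (horner f v)
  from horner.prems show ?case
  proof cases
    case (const w)
    then show ?thesis using polynomial_curve.horner[OF horner.hyps, of "v + w"]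
      by (simp add: algebra_simps)
  next
    case (horner g' w)
    then show ?thesis using polynomial_curve.horner[OF horner.IH[OF horner(2)], of "v + w"]
      by (simp add: algebra_simps)
  qed
qed

lemma polynomial_curve_times: "polynomial_curve f \<Longrightarrow> polynomial_curve (\<lambda>t. t \<odot> f t)"
  using horner[of f 0] by simp

lemma polynomial_curve_scale: "polynomial_curve f \<Longrightarrow> polynomial_curve (\<lambda>t. c \<odot> f t)"
proof (induction rule: polynomial_curve.induct)
  case (const v)
  show ?case by (rule polynomial_curve.const)
next
  case (horner f v)
  then show ?case using polynomial_curve.horner[OF horner.IH, of "c \<odot> v"]
    by (simp add: algebra_simps)
qed

lemma polynomial_curve_poly:
  "polynomial_curve f \<Longrightarrow> polynomial_curve (\<lambda>t. poly p t \<odot> f t)"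
proof (induction p)
  case 0
  show ?case using const[of 0] by simp
next
  case (pCons a p)
  have "polynomial_curve (\<lambda>t. a \<odot> f t + t \<odot> (poly p t \<odot> f t))"
    using pCons by (intro polynomial_curve_add polynomial_curve_times polynomial_curve_scale) auto
  then show ?case by (simp add: algebra_simps)
qed

lemma polynomial_curve_diff:
  "polynomial_curve f \<Longrightarrow> polynomial_curve g \<Longrightarrow> polynomial_curve (\<lambda>t. f t - g t)"
  using polynomial_curve_add[of f "\<lambda>t. (- 1) \<odot> g t"] polynomial_curve_scale[of g "- 1"] by simp

lemma polynomial_curve_sum:
  "(\<And>i. i \<in> I \<Longrightarrow> polynomial_curve (f i)) \<Longrightarrow> polynomial_curve (\<lambda>t. \<Sum>i\<in>I. f i t)"
  by (induction I rule: infinite_finite_induct) (auto intro: const polynomial_curve_add)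

lemma polynomial_curve_functional:
  assumes "Vector_Spaces.linear scale (*) \<phi>" "polynomial_curve f"
  obtains p where "\<And>t. \<phi> (f t) = poly p t"
proof -
  interpret \<phi>: Vector_Spaces.linear scale "(*)" \<phi> by fact
  from assms(2) have "\<exists>p. \<forall>t. \<phi> (f t) = poly p t"
  proof induction
    case (const v)
    show ?case by (rule exI[of _ "[:\<phi> v:]"]) simp
  next
    case (horner f v)
    then obtain p where "\<forall>t. \<phi> (f t) = poly p t" by auto
    then show ?case by (intro exI[of _ "pCons (\<phi> v) p"]) (simp add: \<phi>.add \<phi>.scale)
  qed
  then show ?thesis using that by blast
qed

text \<open>Independence is an open condition. The members of the family are eliminated one at a time, as in
  Gaussian elimination over the polynomials in \<open>t\<close>: a functional \<open>\<phi>\<close> that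
  is 1 on \<open>f j t0\<close> and 0 on the others is used to subtract multiples of \<open>f j\<close>, after clearing
  the denominator \<open>\<phi> (f j t)\<close>, so that the remaining curves lie in the kernel of \<open>\<phi>\<close>.\<close>

theorem indep_family_generic:
  assumes "finite I" "\<And>i. i \<in> I \<Longrightarrow> polynomial_curve (f i)" "indep_family I (\<lambda>i. f i t0)"
  shows "finite {t. \<not> indep_family I (\<lambda>i. f i t)}"
  using assms
proof (induction I arbitrary: f rule: finite_induct)
  case empty
  show ?case by simp
next
  case (insert j I)
  interpret vp: vector_space_pair scale "(*)"
    by unfold_locales (auto simp: algebra_simps)
  have ind: "inj_on (\<lambda>i. f i t0) (insert j I)" "independent ((\<lambda>i. f i t0) ` insert j I)"
    using insert.prems(2) insert.hyps(1) by (auto simp: indep_family_iff)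
  obtain \<phi> where lin: "Vector_Spaces.linear scale (*) \<phi>"
    and \<phi>: "\<And>x. x \<in> (\<lambda>i. f i t0) ` insert j I \<Longrightarrow> \<phi> x = (if x = f j t0 then 1 else 0)"
    using vp.linear_independent_extend[OF ind(2), of "\<lambda>x. if x = f j t0 then 1 else 0"] by blast
  interpret \<phi>: Vector_Spaces.linear scale "(*)" \<phi> by (rule lin)
  have \<phi>j: "\<phi> (f j t0) = 1" using \<phi>[of "f j t0"] by simp
  have \<phi>i: "\<phi> (f i t0) = 0" if "i \<in> I" for i
    using \<phi>[of "f i t0"] that ind(1) insert.hyps(2) by (auto simp: inj_on_def)
  have "\<exists>p. \<forall>t. \<phi> (f i t) = poly p t" if "i \<in> insert j I" for i
    using polynomial_curve_functional[OF lin insert.prems(1)[OF that]]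
    by metis
  then obtain p where p: "\<And>i t. i \<in> insert j I \<Longrightarrow> \<phi> (f i t) = poly (p i) t"
    by metis
  define g where "g i t = poly (p j) t \<odot> f i t - poly (p i) t \<odot> f j t" for i t
  have g_curve: "polynomial_curve (g i)" if "i \<in> I" for i
    unfolding g_def[abs_def]
    using that insert.prems(1) by (intro polynomial_curve_diff polynomial_curve_poly) auto
  have pj: "poly (p j) t0 = 1" using p[of j t0] \<phi>j by simp
  have g0: "g i t0 = f i t0" if "i \<in> I" for i
    using that p[of i t0] \<phi>i pj by (simp add: g_def)
  have "indep_family I (\<lambda>i. f i t0)"
    using insert.prems(2) insert.hyps by (auto simp: indep_family_insert)
  then have "indep_family I (\<lambda>i. g i t0)"
    using indep_family_cong[of I "\<lambda>i. g i t0" "\<lambda>i. f i t0"] g0 by simp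
  then have fin: "finite {t. \<not> indep_family I (\<lambda>i. g i t)}"
    using insert.IH[of g] g_curve by blast
  have "p j \<noteq> 0" using pj by auto
  then have "finite {t. poly (p j) t = 0}" by (rule poly_roots_finite)
  moreover have "indep_family (insert j I) (\<lambda>i. f i t)"
    if t: "poly (p j) t \<noteq> 0" "indep_family I (\<lambda>i. g i t)" for t
    unfolding indep_family_def
  proof (intro allI impI)
    fix c assume c: "(\<Sum>i\<in>insert j I. c i \<odot> f i t) = 0"
    have "\<phi> (\<Sum>i\<in>insert j I. c i \<odot> f i t) = (\<Sum>i\<in>insert j I. c i * poly (p i) t)"
      unfolding \<phi>.sum using p by (intro sum.cong) (simp_all add: \<phi>.scale)
    then have "(\<Sum>i\<in>insert j I. c i * poly (p i) t) = 0"
      using c \<phi>.zero by metis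
    then have pI: "(\<Sum>i\<in>I. c i * poly (p i) t) = - (c j * poly (p j) t)"
      using insert.hyps by (simp add: add_eq_0_iff)
    have fI: "(\<Sum>i\<in>I. c i \<odot> f i t) = - (c j \<odot> f j t)"
      using c insert.hyps by (simp add: add_eq_0_iff)
    \<comment> \<open>The terms with \<open>f j\<close> cancel by the relation between the values of \<open>\<phi>\<close>.\<close>
    have "(\<Sum>i\<in>I. c i \<odot> g i t)
        = poly (p j) t \<odot> (\<Sum>i\<in>I. c i \<odot> f i t) - (\<Sum>i\<in>I. c i * poly (p i) t) \<odot> f j t"
      by (simp add: g_def scale_sum_right scale_sum_left sum_subtractf algebra_simps)
    also have "\<dots> = 0" unfolding fI pI by (simp add: algebra_simps)
    finally have cI: "c i = 0" if "i \<in> I" for i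
      using indep_familyD[OF t(2)] that by blast
    then have "c j = 0" using pI t(1) by simp
    then show "\<forall>i\<in>insert j I. c i = 0" using cI by blast
  qed
  ultimately have "{t. \<not> indep_family (insert j I) (\<lambda>i. f i t)}
      \<subseteq> {t. poly (p j) t = 0} \<union> {t. \<not> indep_family I (\<lambda>i. g i t)}"
    "finite ({t. poly (p j) t = 0} \<union> {t. \<not> indep_family I (\<lambda>i. g i t)})"
    using fin by auto
  then show ?case by (rule finite_subset)
qed

end

text \<open>Adding 1 to the product of all \<open>x - a\<close> over a finite field gives a polynomial without roots.\<close>

lemma infinite_UNIV_alg_closed: "infinite (UNIV :: 'a::alg_closed_field set)"
proof
  assume fin: "finite (UNIV :: 'a set)"
  define p :: "'a poly" where "p = (\<Prod>a\<in>UNIV. [:- a, 1:])"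
  have p: "poly p x = 0" for x using fin by (auto simp: p_def poly_prod prod_zero_iff)
  have "degree p = (\<Sum>a\<in>(UNIV :: 'a set). degree [:- a, 1:])"
    unfolding p_def by (rule degree_prod_sum_eq) auto
  also have "\<dots> = card (UNIV :: 'a set)" by simp
  finally have "degree (p + 1) > 0"
    using fin by (simp add: degree_add_eq_left finite_UNIV_card_ge_0)
  then obtain x where "poly (p + 1) x = 0" using alg_closed_imp_poly_has_root by blast
  then show False using p by simp
qed

section \<open>Polynomials in an endomorphism\<close>

context coordinate_space
begin

definition poly_endo :: "('b \<Rightarrow> 'b) \<Rightarrow> 'a poly \<Rightarrow> 'b \<Rightarrow> 'b" where
  "poly_endo A q w = (\<Sum>i\<le>degree q. coeff q i \<odot> (A ^^ i) w)"

lemma poly_endo_bound: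
  assumes "degree q \<le> n"
  shows "poly_endo A q w = (\<Sum>i\<le>n. coeff q i \<odot> (A ^^ i) w)"
  unfolding poly_endo_def
  using assms by (intro sum.mono_neutral_left) (auto simp: coeff_eq_0)

lemma poly_endo_root_factor:
  assumes "Vector_Spaces.linear scale scale A"
  shows "poly_endo A ([:- l, 1:] * q) w = A (poly_endo A q w) - l \<odot> poly_endo A q w"
proof -
  interpret A: Vector_Spaces.linear scale scale A by fact
  let ?n = "Suc (degree q)"
  have deg: "degree ([:- l, 1:] * q) \<le> ?n"
    using degree_mult_le[of "[:- l, 1:]" q] by simp
  have c: "coeff ([:- l, 1:] * q) i = coeff (pCons 0 q) i - l * coeff q i" for i
    by simp
  have "poly_endo A ([:- l, 1:] * q) w
      = (\<Sum>i\<le>?n. coeff (pCons 0 q) i \<odot> (A ^^ i) w) - l \<odot> (\<Sum>i\<le>?n. coeff q i \<odot> (A ^^ i) w)"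
    unfolding poly_endo_bound[OF deg] c
    by (simp only: scale_left_diff_distrib sum_subtractf scale_sum_right scale_scale)
  also have "(\<Sum>i\<le>?n. coeff q i \<odot> (A ^^ i) w) = poly_endo A q w"
    by (rule poly_endo_bound[symmetric]) simp
  also have "(\<Sum>i\<le>?n. coeff (pCons 0 q) i \<odot> (A ^^ i) w) = A (poly_endo A q w)"
    unfolding sum.atMost_Suc_shift poly_endo_def by (simp add: A.sum A.scale)
  finally show ?thesis .
qed

text \<open>If \<open>q\<close> annihilates \<open>w\<close> and \<open>q = (x - l) r\<close>, then either \<open>r\<close> already annihilates \<open>w\<close>, or \<open>r(A) w\<close> is
  an eigenvector for \<open>l\<close>. Knowing that the eigenvalue is a root of \<open>q\<close> is what allows the
  eigenvalue 0 to be excluded later.\<close>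

lemma eigenvector_exists:
  fixes A :: "'b \<Rightarrow> 'b" and q :: "'a poly"
  assumes alg_closed: "\<And>p :: 'a poly. degree p > 0 \<Longrightarrow> \<exists>x. poly p x = 0"
    and lin: "Vector_Spaces.linear scale scale A"
    and T: "subspace T" "\<And>x. x \<in> T \<Longrightarrow> A x \<in> T"
    and q: "q \<noteq> 0" "w \<in> T" "w \<noteq> 0" "poly_endo A q w = 0"
  obtains l v where "poly q l = 0" "v \<in> T" "v \<noteq> 0" "A v = l \<odot> v"
proof -
  have pow: "(A ^^ i) w \<in> T" for i
    by (induction i) (auto simp: q T(2))
  have "\<exists>l v. poly q l = 0 \<and> v \<in> T \<and> v \<noteq> 0 \<and> A v = l \<odot> v"
    using q(1,4)
  proof (induction "degree q" arbitrary: q)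
    case 0
    then obtain c where "q = [:c:]" by (metis degree_eq_zeroE)
    then show ?case using 0 q(3) by (simp add: poly_endo_def)
  next
    case (Suc n)
    then obtain l where l: "poly q l = 0" using alg_closed[of q] by auto
    then obtain r where r: "q = [:- l, 1:] * r" by (auto simp: poly_eq_0_iff_dvd elim: dvdE)
    have r0: "r \<noteq> 0" using Suc.prems r by auto
    have deg: "n = degree r"
      using Suc.hyps(2) r0 unfolding r by (subst (asm) degree_mult_eq) auto
    show ?case
    proof (cases "poly_endo A r w = 0")
      case True
      then show ?thesis using Suc.hyps(1)[OF deg r0] r by auto
    next
      case False
      have "poly_endo A r w \<in> T"
        unfolding poly_endo_def using T(1) pow by (intro subspace_sum subspace_scale) auto
      moreover have "A (poly_endo A r w) = l \<odot> poly_endo A r w"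
        using Suc.prems(2) poly_endo_root_factor[OF lin] r by simp
      ultimately show ?thesis using False l by blast
    qed
  qed
  then show ?thesis using that by blast
qed

end

section \<open>Tori in Lie 2-algebras over an algebraically closed field\<close>

lemma two_eq_0: "CHAR('k) = 2 \<Longrightarrow> (2 :: 'k::ring_1) = 0"
  using of_nat_CHAR[where 'a = 'k] by simp

locale lie2_algebra_alg_closed = lie2_algebra scale bracket sq
  for scale :: "'k::alg_closed_field \<Rightarrow> 'g::ab_group_add \<Rightarrow> 'g" (infixr \<open>\<odot>\<close> 75)
    and bracket (\<open>\<lbrakk>_, _\<rbrakk>\<close>) and sq +
  assumes char_2: "CHAR('k) = 2"
begin

definition finite_basis :: "'g set" where
  "finite_basis = (SOME B. finite B \<and> independent B \<and> span B = UNIV)"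

lemma finite_basis: "finite finite_basis" "independent finite_basis" "span finite_basis = UNIV"
proof -
  obtain S where S: "finite S" "span S = UNIV" using finite_dimensional by blast
  obtain B where B: "B \<subseteq> S" "independent B" "S \<subseteq> span B"
    using maximal_independent_subset[of S] by blast
  have "span B = UNIV"
    using span_mono[OF B(3)] S(2) by (auto simp: span_span)
  then have "\<exists>B. finite B \<and> independent B \<and> span B = UNIV"
    using B S(1) finite_subset by blast
  from someI_ex[OF this]
  show "finite finite_basis" "independent finite_basis" "span finite_basis = UNIV"
    unfolding finite_basis_def by auto
qed

sublocale finite_dimensional_vector_space scale finite_basis
  by unfold_locales (fact finite_basis)+

sublocale coordinate_space scale ..

lemma indep_family_card_le_dim:
  assumes "indep_family I v" "finite I" "\<And>i. i \<in> I \<Longrightarrow> v i \<in> S"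
  shows "card I \<le> dim S"
proof -
  have "card (v ` I) \<le> dim S"
    using assms by (intro independent_card_le_dim) (auto simp: indep_family_iff)
  then show ?thesis using assms by (simp add: indep_family_iff card_image)
qed

lemma add_self [simp]: "(x :: 'g) + x = 0"
proof -
  have "(1 + 1 :: 'k) = 0" using two_eq_0[OF char_2] by simp
  then have "(1 + 1 :: 'k) \<odot> x = 0" by simp
  then show ?thesis by (simp only: scale_left_distrib scale_one)
qed

lemma bracket_linear_right: "Vector_Spaces.linear scale scale (bracket x)"
  by unfold_locales (simp_all add: bracket_add_right bracket_scale_right)

lemma bracket_zero_right [simp]: "\<lbrakk>x, 0\<rbrakk> = 0"
  using bracket_scale_right[of x 0 0] by simp

lemma bracket_zero_left [simp]: "\<lbrakk>0, x\<rbrakk> = 0"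
  using bracket_scale_left[of 0 0 x] by simp

lemma bracket_sum_right: "\<lbrakk>x, \<Sum>i\<in>I. f i\<rbrakk> = (\<Sum>i\<in>I. \<lbrakk>x, f i\<rbrakk>)"
  by (induction I rule: infinite_finite_induct) (simp_all add: bracket_add_right)

lemma bracket_sum_left: "\<lbrakk>\<Sum>i\<in>I. f i, x\<rbrakk> = (\<Sum>i\<in>I. \<lbrakk>f i, x\<rbrakk>)"
  by (induction I rule: infinite_finite_induct) (simp_all add: bracket_add_left)

lemma bracket_commute: "\<lbrakk>x, y\<rbrakk> = \<lbrakk>y, x\<rbrakk>"
proof -
  have "\<lbrakk>x + y, x + y\<rbrakk> = 0" by (rule bracket_self)
  then have *: "\<lbrakk>x, y\<rbrakk> + \<lbrakk>y, x\<rbrakk> = 0"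
    unfolding bracket_add_left bracket_add_right by (simp add: bracket_self add.commute)
  have "\<lbrakk>x, y\<rbrakk> = \<lbrakk>x, y\<rbrakk> + (\<lbrakk>y, x\<rbrakk> + \<lbrakk>y, x\<rbrakk>)" by simp
  also have "\<dots> = \<lbrakk>y, x\<rbrakk>" using * by (simp only: add.assoc[symmetric]) simp
  finally show ?thesis .
qed

lemma sq_zero [simp]: "sq 0 = 0"
  using sq_scale[of 0 0] by simp

text \<open>On commuting elements the 2-map is additive, hence semilinear for the Frobenius map.\<close>

lemma sq_sum_commuting:
  assumes "finite I" "\<And>i j. i \<in> I \<Longrightarrow> j \<in> I \<Longrightarrow> \<lbrakk>v i, v j\<rbrakk> = 0"
  shows "sq (\<Sum>i\<in>I. c i \<odot> v i) = (\<Sum>i\<in>I. (c i)\<^sup>2 \<odot> sq (v i))"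
  using assms
proof (induction I rule: finite_induct)
  case (insert j I)
  have "\<lbrakk>c j \<odot> v j, \<Sum>i\<in>I. c i \<odot> v i\<rbrakk> = 0"
    unfolding bracket_sum_right
    using insert.prems by (intro sum.neutral) (auto simp: bracket_scale_left bracket_scale_right)
  then show ?case using insert by (simp add: sq_add sq_scale)
qed simp

abbreviation sq_pow :: "nat \<Rightarrow> 'g \<Rightarrow> 'g" where "sq_pow i x \<equiv> (sq ^^ i) x"

lemma bracket_sq_pow: "\<lbrakk>sq_pow i x, y\<rbrakk> = (bracket x ^^ (2 ^ i)) y"
proof (induction i arbitrary: y)
  case (Suc i)
  show ?case by (simp add: ad_sq Suc funpow_add mult_2)
qed simp

lemma bracket_sq_pow_eq_0: "\<lbrakk>x, y\<rbrakk> = 0 \<Longrightarrow> \<lbrakk>sq_pow i x, y\<rbrakk> = 0"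
  by (induction i) (simp_all add: ad_sq)

lemma bracket_sq_pow_sq_pow_eq_0: "\<lbrakk>x, y\<rbrakk> = 0 \<Longrightarrow> \<lbrakk>sq_pow i x, sq_pow j y\<rbrakk> = 0"
  using bracket_sq_pow_eq_0 bracket_commute by metis

lemma bracket_sq_pow_same [simp]: "\<lbrakk>sq_pow i x, sq_pow j x\<rbrakk> = 0"
  by (rule bracket_sq_pow_sq_pow_eq_0) (rule bracket_self)

lemma sq_pow_add_scale_commuting:
  assumes "\<lbrakk>x, z\<rbrakk> = 0"
  shows "sq_pow i (x + t \<odot> z) = sq_pow i x + t ^ (2 ^ i) \<odot> sq_pow i z"
  by (induction i)
    (simp_all add: sq_add sq_scale bracket_scale_right bracket_sq_pow_sq_pow_eq_0 assms
      power_mult[symmetric] mult.commute)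

lemma polynomial_curve_sq:
  assumes "polynomial_curve f"
  shows "polynomial_curve (\<lambda>t. sq (f t))"
  using assms
proof induction
  case (const v)
  show ?case by (rule polynomial_curve.const)
next
  case (horner f v)
  have "polynomial_curve (\<lambda>t. \<lbrakk>v, f t\<rbrakk>)"
    using horner.hyps
  proof induction
    case (const w)
    show ?case by (rule polynomial_curve.const)
  next
    case (horner f w)
    then show ?case using polynomial_curve.horner[OF horner.IH, of "\<lbrakk>v, w\<rbrakk>"]
      by (simp add: bracket_add_right bracket_scale_right)
  qed
  then have "polynomial_curve (\<lambda>t. sq v + t \<odot> (t \<odot> sq (f t)) + t \<odot> \<lbrakk>v, f t\<rbrakk>)"
    using horner.IH
    by (intro polynomial_curve_add polynomial_curve_times polynomial_curve.const)
  then show ?case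
    by (simp add: sq_add sq_scale bracket_scale_right power2_eq_square add.assoc)
qed

lemma polynomial_curve_sq_pow: "polynomial_curve f \<Longrightarrow> polynomial_curve (\<lambda>t. sq_pow i (f t))"
  by (induction i) (simp_all add: polynomial_curve_sq)

lemma polynomial_curve_bracket_left:
  "polynomial_curve f \<Longrightarrow> polynomial_curve (\<lambda>t. \<lbrakk>f t, y\<rbrakk>)"
proof (induction rule: polynomial_curve.induct)
  case (const w)
  show ?case by (rule polynomial_curve.const)
next
  case (horner f w)
  then show ?case using polynomial_curve.horner[OF horner.IH, of "\<lbrakk>w, y\<rbrakk>"]
    by (simp add: bracket_add_left bracket_scale_left)
qed

lemma square_root_exists: "\<exists>d. d\<^sup>2 = (c :: 'k)"
  using nth_root_exists[of 2 c] by auto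

lemma torus_subspace: "torus T \<Longrightarrow> subspace T"
  by (simp add: torus_def subalgebra_def)

lemma torus_bracket: "torus T \<Longrightarrow> x \<in> T \<Longrightarrow> y \<in> T \<Longrightarrow> \<lbrakk>x, y\<rbrakk> \<in> T"
  by (simp add: torus_def subalgebra_def)

lemma torus_sq_pow: "torus T \<Longrightarrow> x \<in> T \<Longrightarrow> sq_pow i x \<in> T"
  by (induction i) (auto simp: torus_def bij_betw_def)

lemma sq_pow_relation:
  obtains k c where "indep_family {..<k} (\<lambda>i. sq_pow i x)" "sq_pow k x = (\<Sum>i<k. c i \<odot> sq_pow i x)"
proof -
  let ?P = "\<lambda>k. \<not> indep_family {..<k} (\<lambda>i. sq_pow i x)"
  have "?P (Suc (dim UNIV))"
    using indep_family_card_le_dim[of "{..<Suc (dim UNIV)}" _ UNIV] by fastforce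
  then have P: "?P (LEAST k. ?P k)" by (rule LeastI)
  then have "(LEAST k. ?P k) \<noteq> 0" by (intro notI) simp
  then obtain k where k: "(LEAST k. ?P k) = Suc k" by (metis not0_implies_Suc)
  have ind: "indep_family {..<k} (\<lambda>i. sq_pow i x)"
    using not_less_Least[of k ?P] k by simp
  then have "sq_pow k x \<in> span ((\<lambda>i. sq_pow i x) ` {..<k})"
    using P unfolding k lessThan_Suc by (simp add: indep_family_insert)
  then obtain c where "sq_pow k x = (\<Sum>i\<in>{..<k}. c i \<odot> sq_pow i x)"
    by (rule span_image_sum[OF finite_lessThan])
  then show ?thesis using ind that by blast
qed

text \<open>In the first linear relation between the iterates \<open>x, sq x, sq (sq x), \<dots>\<close> the element \<open>x\<close> itself
  occurs. Otherwise, the field being perfect, the relation would be the image under the 2-map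
  of a shorter one, and the 2-map is injective on a torus.\<close>

lemma torus_sq_pow_relation_coeff:
  assumes T: "torus T" and x: "x \<in> T" "x \<noteq> 0"
    and ind: "indep_family {..<k} (\<lambda>i. sq_pow i x)"
    and rel: "sq_pow k x = (\<Sum>i<k. c i \<odot> sq_pow i x)"
  shows "k > 0" "c 0 \<noteq> 0"
proof -
  show k: "k > 0" using rel x by (cases k) auto
  then obtain n where n: "k = Suc n" by (cases k) auto
  show "c 0 \<noteq> 0"
  proof
    assume c0: "c 0 = 0"
    \<comment> \<open>Square roots of the coefficients turn the relation into an equality of two values of the 2-map.\<close>
    have "\<exists>d. \<forall>i. (d i)\<^sup>2 = c i" by (intro choice allI square_root_exists)
    then obtain d where d: "\<And>i. (d i)\<^sup>2 = c i" by blast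
    let ?y = "\<Sum>i<n. d (Suc i) \<odot> sq_pow i x"
    have "sq ?y = (\<Sum>i<n. c (Suc i) \<odot> sq_pow (Suc i) x)"
      by (simp add: sq_sum_commuting d)
    also have "\<dots> = (\<Sum>i<k. c i \<odot> sq_pow i x)"
      unfolding n sum.lessThan_Suc_shift using c0 by simp
    also have "\<dots> = sq_pow k x" by (rule rel[symmetric])
    also have "\<dots> = sq (sq_pow n x)" by (simp add: n)
    finally have eq: "sq ?y = sq (sq_pow n x)" .
    have "?y \<in> T" using T x by (intro subspace_sum subspace_scale torus_sq_pow torus_subspace)
    then have "?y = sq_pow n x"
      using eq T x torus_sq_pow[OF T] by (auto simp: torus_def bij_betw_def inj_on_def)
    then have "sq_pow n x = ?y" by simp
    also have "\<dots> \<in> span ((\<lambda>i. sq_pow i x) ` {..<n})"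
      by (intro span_sum span_scale span_base imageI)
    finally have "sq_pow n x \<in> span ((\<lambda>i. sq_pow i x) ` {..<n})" .
    then show False using ind unfolding n lessThan_Suc by (simp add: indep_family_insert)
  qed
qed

text \<open>By the relation between the iterates of \<open>a\<close>, the operator \<open>ad a\<close> is annihilated by a polynomial
  \<open>x q(x)\<close> with \<open>q(0) \<noteq> 0\<close>. If \<open>[a, b] \<noteq> 0\<close>, then \<open>q(ad a)\<close> kills \<open>[a, b]\<close>, so \<open>ad a\<close> has an eigenvector \<open>v\<close>
  in the torus with an eigenvalue \<open>l \<noteq> 0\<close>. Then \<open>(ad v)^2\<close> kills \<open>a\<close>, which means that all the
  iterates of \<open>v\<close> except possibly \<open>v\<close> commute with \<open>a\<close>; but \<open>v\<close> is a combination of those.\<close>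

theorem torus_abelian:
  assumes T: "torus T" and a: "a \<in> T" and b: "b \<in> T"
  shows "\<lbrakk>a, b\<rbrakk> = 0"
proof (rule ccontr)
  assume ab: "\<lbrakk>a, b\<rbrakk> \<noteq> 0"
  then have a0: "a \<noteq> 0" by auto
  obtain k c where ind: "indep_family {..<k} (\<lambda>i. sq_pow i a)" and rel: "sq_pow k a = (\<Sum>i<k. c i \<odot> sq_pow i a)"
    by (rule sq_pow_relation)
  have k: "k > 0" and c0: "c 0 \<noteq> 0" using torus_sq_pow_relation_coeff[OF T a a0 ind rel] by auto
  \<comment> \<open>The exponents are lowered by 1 because \<open>q\<close> is applied to \<open>[a, b]\<close> rather than to \<open>b\<close>.\<close>
  define q :: "'k poly" where
    "q = monom 1 (2 ^ k - 1) - (\<Sum>i<k. monom (c i) (2 ^ i - 1))"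
  have exp: "(2::nat) ^ i - 1 = 0 \<longleftrightarrow> i = 0" for i
    using less_exp[of i] by (cases i) auto
  have q0: "coeff q 0 = - c 0"
  proof -
    have "(\<Sum>i<k. coeff (monom (c i) (2 ^ i - 1)) 0) = (\<Sum>i<k. if i = 0 then c 0 else 0)"
      by (rule sum.cong) (use exp in \<open>auto simp: coeff_monom\<close>)
    then show ?thesis using k exp[of k] by (simp add: q_def coeff_sum coeff_monom)
  qed
  have "poly_endo (bracket a) q \<lbrakk>a, b\<rbrakk> = 0"
  proof -
    let ?N = "2 ^ k - 1 :: nat"
    have le: "2 ^ i - 1 \<le> ?N" if "i < k" for i
      using that by (intro diff_le_mono power_increasing) auto
    have deg: "degree q \<le> ?N"
      unfolding q_def using le
      by (intro degree_diff_le degree_sum_le degree_monom_le)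
        (auto intro: order.trans[OF degree_monom_le])
    have mon: "(\<Sum>j\<le>?N. coeff (monom e m) j \<odot> (bracket a ^^ j) \<lbrakk>a, b\<rbrakk>) = e \<odot> (bracket a ^^ m) \<lbrakk>a, b\<rbrakk>"
      if "m \<le> ?N" for m e
    proof -
      have "(\<Sum>j\<le>?N. coeff (monom e m) j \<odot> (bracket a ^^ j) \<lbrakk>a, b\<rbrakk>)
          = (\<Sum>j\<le>?N. if j = m then e \<odot> (bracket a ^^ m) \<lbrakk>a, b\<rbrakk> else 0)"
        by (rule sum.cong) (auto simp: coeff_monom)
      then show ?thesis using that by simp
    qed
    have step: "(bracket a ^^ (2 ^ i - 1)) \<lbrakk>a, b\<rbrakk> = \<lbrakk>sq_pow i a, b\<rbrakk>" for i
    proof -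
      have "(bracket a ^^ (2 ^ i - 1)) \<lbrakk>a, b\<rbrakk> = (bracket a ^^ (Suc (2 ^ i - 1))) b"
        by (simp only: funpow_Suc_right o_apply)
      then show ?thesis by (simp add: bracket_sq_pow)
    qed
    have "poly_endo (bracket a) q \<lbrakk>a, b\<rbrakk>
        = (\<Sum>j\<le>?N. coeff (monom 1 ?N) j \<odot> (bracket a ^^ j) \<lbrakk>a, b\<rbrakk>)
        - (\<Sum>i<k. \<Sum>j\<le>?N. coeff (monom (c i) (2 ^ i - 1)) j \<odot> (bracket a ^^ j) \<lbrakk>a, b\<rbrakk>)"
      by (subst sum.swap, subst poly_endo_bound[OF deg])
        (simp only: q_def coeff_diff coeff_sum scale_left_diff_distrib scale_sum_left sum_subtractf)
    also have "\<dots> = \<lbrakk>sq_pow k a, b\<rbrakk> - (\<Sum>i<k. c i \<odot> \<lbrakk>sq_pow i a, b\<rbrakk>)"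
      using mon le by (simp add: step[unfolded One_nat_def])
    also have "\<dots> = 0"
      unfolding rel by (simp add: bracket_sum_left bracket_scale_left)
    finally show ?thesis .
  qed
  moreover have "q \<noteq> 0" using q0 c0 by auto
  moreover have "bracket a x \<in> T" if "x \<in> T" for x using torus_bracket[OF T a that] .
  ultimately obtain l v where l: "poly q l = 0" and v: "v \<in> T" "v \<noteq> 0" "\<lbrakk>a, v\<rbrakk> = l \<odot> v"
    using eigenvector_exists[OF alg_closed_imp_poly_has_root bracket_linear_right[of a]
        torus_subspace[OF T], where q = q and w = "\<lbrakk>a, b\<rbrakk>"] ab torus_bracket[OF T a b] by blast
  have l0: "l \<noteq> 0" using l q0 c0 by (auto simp: poly_0_coeff_0)
  have sq_v: "\<lbrakk>sq v, a\<rbrakk> = 0"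
    by (simp add: ad_sq bracket_commute[of v a] v(3) bracket_scale_right bracket_self)
  obtain m d where ind': "indep_family {..<m} (\<lambda>i. sq_pow i v)" and rel': "sq_pow m v = (\<Sum>i<m. d i \<odot> sq_pow i v)"
    by (rule sq_pow_relation)
  have m: "m > 0" and d0: "d 0 \<noteq> 0" using torus_sq_pow_relation_coeff[OF T v(1,2) ind' rel'] by auto
  have pos: "\<lbrakk>sq_pow i v, a\<rbrakk> = 0" if "i > 0" for i
    using bracket_sq_pow_eq_0[OF sq_v, of "i - 1"] that
    by (cases i) (simp_all add: funpow_swap1)
  have "0 = \<lbrakk>sq_pow m v, a\<rbrakk>" using pos m by simp
  also have "\<dots> = (\<Sum>i<m. d i \<odot> \<lbrakk>sq_pow i v, a\<rbrakk>)"
    unfolding rel' by (simp add: bracket_sum_left bracket_scale_left)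
  also have "\<dots> = (\<Sum>i<m. if i = 0 then d 0 \<odot> \<lbrakk>v, a\<rbrakk> else 0)"
    by (rule sum.cong) (auto simp: pos)
  also have "\<dots> = d 0 \<odot> \<lbrakk>v, a\<rbrakk>" using m by simp
  finally have "\<lbrakk>v, a\<rbrakk> = 0" using d0 by simp
  then show False using v l0 by (simp add: bracket_commute[of v a])
qed

text \<open>A torus is spanned by the iterates of one element. Take \<open>x\<close> with as many independent iterates as
  possible, say \<open>k\<close>, and suppose that \<open>z\<close> lies outside their span. Along the line \<open>y t = x + t z\<close> the
  relation \<open>sq^k x = c_0 x + \<dots>\<close> fails: subtracting its right-hand side, formed for \<open>y t\<close>, from
  \<open>sq^k (y t)\<close> leaves a vector divisible by \<open>t\<close>, because \<open>sq^i (y t) = sq^i x + t^(2^i) sq^i z\<close>. The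
  quotient has the value \<open>- c_0 z\<close> at \<open>t = 0\<close>, since only \<open>i = 0\<close> contributes to first order. As
  \<open>c_0 \<noteq> 0\<close>, a generic \<open>y t\<close> has \<open>k + 1\<close> independent iterates.\<close>

lemma torus_generic_element:
  assumes T: "torus T"
  obtains x where "x \<in> T" "indep_family {..<dim T} (\<lambda>i. sq_pow i x)"
proof -
  let ?P = "\<lambda>k. \<exists>x\<in>T. indep_family {..<k} (\<lambda>i. sq_pow i x)"
  have bound: "k \<le> dim T" if "?P k" for k
    using that indep_family_card_le_dim[of "{..<k}" _ T] torus_sq_pow[OF T] by fastforce
  have P0: "?P 0" using subspace_0[OF torus_subspace[OF T]] by auto
  define k where "k = Greatest ?P"
  have Pk: "?P k" unfolding k_def using P0 bound by (rule GreatestI_nat)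
  have max: "m \<le> k" if "?P m" for m
    unfolding k_def using that bound by (rule Greatest_le_nat)
  have "k = dim T"
  proof (rule ccontr)
    assume "k \<noteq> dim T"
    then have less: "k < dim T" using bound[OF Pk] by simp
    obtain x where x: "x \<in> T" and ind: "indep_family {..<k} (\<lambda>i. sq_pow i x)" using Pk by blast
    let ?S = "span ((\<lambda>i. sq_pow i x) ` {..<k})"
    have "\<not> T \<subseteq> ?S"
      using dim_le_card[of T "(\<lambda>i. sq_pow i x) ` {..<k}"] card_image_le[of "{..<k}" "\<lambda>i. sq_pow i x"] less
      by fastforce
    then obtain z where z: "z \<in> T" "z \<notin> ?S" by blast
    have "\<not> indep_family {..<Suc k} (\<lambda>i. sq_pow i x)" using max[of "Suc k"] x by auto
    then have "sq_pow k x \<in> ?S" using ind by (simp add: lessThan_Suc indep_family_insert)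
    then obtain c where rel: "sq_pow k x = (\<Sum>i\<in>{..<k}. c i \<odot> sq_pow i x)"
      by (rule span_image_sum[OF finite_lessThan])
    have "x \<noteq> 0"
    proof
      assume "x = 0"
      have "sq_pow i 0 = 0" for i by (induction i) simp_all
      then have "k = 0"
        using indep_familyD[OF ind, of "\<lambda>_. 1" 0] \<open>x = 0\<close> by auto
      have "z \<noteq> 0" using z span_zero by auto
      then have "indep_family {..<Suc 0} (\<lambda>i. sq_pow i z)" by (simp add: indep_family_def)
      then show False using max[of "Suc 0"] z \<open>k = 0\<close> by auto
    qed
    then have k: "k > 0" and c0: "c 0 \<noteq> 0"
      using torus_sq_pow_relation_coeff[OF T x _ ind] rel by auto
    have comm: "\<lbrakk>x, z\<rbrakk> = 0" using torus_abelian[OF T] x z by blast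
    define y where "y t = x + t \<odot> z" for t
    have y_curve: "polynomial_curve y"
      using horner[OF const[of z], of x] by (simp add: y_def[abs_def])
    define g where "g t = sq_pow k (y t) - (\<Sum>i<k. c i \<odot> sq_pow i (y t))" for t
    define g' where "g' t = t ^ (2 ^ k - 1) \<odot> sq_pow k z - (\<Sum>i<k. (c i * t ^ (2 ^ i - 1)) \<odot> sq_pow i z)" for t
    have pow: "t * t ^ (2 ^ i - 1) = t ^ (2 ^ i)" for t :: 'k and i
      by (simp flip: power_Suc)
    have pow': "t * (e * t ^ (2 ^ i - Suc 0)) = e * t ^ (2 ^ i)" for t e :: 'k and i
      using pow[of t i] by (simp add: mult.left_commute[of t])
    have g: "g t = t \<odot> g' t" for t
      unfolding g_def g'_def y_def sq_pow_add_scale_commuting[OF comm]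
      by (simp add: scale_right_distrib sum.distrib rel scale_right_diff_distrib scale_sum_right
          pow[unfolded One_nat_def] pow')
    have g'_curve: "polynomial_curve g'"
    proof -
      have 1: "polynomial_curve (\<lambda>t. t ^ n \<odot> w)" for n w
        using polynomial_curve_poly[OF const[of w], of "monom 1 n"] by (simp add: poly_monom)
      have "polynomial_curve (\<lambda>t. t ^ (2 ^ k - 1) \<odot> sq_pow k z
          - (\<Sum>i<k. c i \<odot> (t ^ (2 ^ i - 1) \<odot> sq_pow i z)))"
        by (intro polynomial_curve_diff polynomial_curve_sum polynomial_curve_scale 1)
      then show ?thesis by (simp add: g'_def[abs_def])
    qed
    have exp: "(2::nat) ^ i - 1 = 0 \<longleftrightarrow> i = 0" for i using less_exp[of i] by (cases i) auto
    have g'0: "g' 0 = - (c 0 \<odot> z)"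
    proof -
      have "(\<Sum>i<k. (c i * 0 ^ (2 ^ i - 1)) \<odot> sq_pow i z) = (\<Sum>i<k. if i = 0 then c 0 \<odot> z else 0)"
        by (rule sum.cong) (use exp in \<open>auto simp: power_0_left\<close>)
      then show ?thesis using k exp[of k] by (simp add: g'_def power_0_left)
    qed
    \<comment> \<open>Independence is read off at \<open>t = 0\<close>, with \<open>g\<close> divided by \<open>t\<close> in place of the last iterate.\<close>
    let ?f = "\<lambda>i t. if i = k then g' t else sq_pow i (y t)"
    have "finite {t. \<not> indep_family {..<Suc k} (\<lambda>i. ?f i t)}"
    proof (rule indep_family_generic[where ?t0.0 = 0])
      show "polynomial_curve (?f i)" for i
        using g'_curve polynomial_curve_sq_pow[OF y_curve, of i] by (cases "i = k") auto
      have "- (c 0 \<odot> z) \<notin> ?S"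
        using z c0 span_neg[of "- (c 0 \<odot> z)"] span_scale[of "c 0 \<odot> z" _ "inverse (c 0)"] by auto
      moreover have "indep_family {..<k} (\<lambda>i. ?f i 0)"
        using ind indep_family_cong[of "{..<k}" "\<lambda>i. ?f i 0" "\<lambda>i. sq_pow i x"] by (simp add: y_def)
      moreover have "(\<lambda>i. ?f i 0) ` {..<k} = (\<lambda>i. sq_pow i x) ` {..<k}"
        by (rule image_cong) (auto simp: y_def)
      ultimately show "indep_family {..<Suc k} (\<lambda>i. ?f i 0)"
        unfolding lessThan_Suc by (subst indep_family_insert) (auto simp: g'0)
    qed simp
    then have "finite (insert 0 {t. \<not> indep_family {..<Suc k} (\<lambda>i. ?f i t)})" by simp
    from ex_new_if_finite[OF infinite_UNIV_alg_closed this]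
    obtain t where t: "t \<noteq> 0" and ind_t: "indep_family {..<Suc k} (\<lambda>i. ?f i t)" by auto
    let ?St = "span ((\<lambda>i. sq_pow i (y t)) ` {..<k})"
    have im: "(\<lambda>i. ?f i t) ` {..<k} = (\<lambda>i. sq_pow i (y t)) ` {..<k}"
      by (rule image_cong) auto
    have "indep_family (insert k {..<k}) (\<lambda>i. ?f i t)"
      using ind_t by (simp only: lessThan_Suc)
    then have "indep_family {..<k} (\<lambda>i. ?f i t) \<and> ?f k t \<notin> span ((\<lambda>i. ?f i t) ` {..<k})"
      by (rule indep_family_insert[THEN iffD1, rotated 2]) simp_all
    then have "indep_family {..<k} (\<lambda>i. ?f i t)" and "g' t \<notin> ?St"
      unfolding im by simp_all
    moreover have "indep_family {..<k} (\<lambda>i. ?f i t) = indep_family {..<k} (\<lambda>i. sq_pow i (y t))"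
      by (rule indep_family_cong) auto
    moreover have "sq_pow k (y t) \<notin> ?St"
    proof
      assume "sq_pow k (y t) \<in> ?St"
      then have "g t \<in> ?St"
        unfolding g_def by (intro span_diff span_sum span_scale) (auto intro: span_base)
      then have "inverse t \<odot> g t \<in> ?St" by (rule span_scale)
      then show False using \<open>g' t \<notin> ?St\<close> t by (simp add: g)
    qed
    ultimately have "indep_family {..<Suc k} (\<lambda>i. sq_pow i (y t))"
      by (simp add: lessThan_Suc indep_family_insert)
    moreover have "y t \<in> T"
      unfolding y_def using x z by (intro subspace_add subspace_scale torus_subspace T)
    ultimately show False using max[of "Suc k"] by auto
  qed
  then show ?thesis using Pk that by blast
qed

definition centralizer :: "'g \<Rightarrow> 'g set" where
  "centralizer a = {z. \<lbrakk>a, z\<rbrakk> = 0}"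

lemma subspace_centralizer: "subspace (centralizer a)"
  by (auto simp: subspace_def centralizer_def bracket_add_right bracket_scale_right)

text \<open>The bound on tori. Let \<open>x\<close> have iterates spanning \<open>T\<close>, and move along the line \<open>y t\<close> from \<open>a\<close> at
  \<open>t = 0\<close> to \<open>x\<close> at \<open>t = 1\<close>. For generic \<open>t\<close> the rank of \<open>ad (y t)\<close> is at least that of \<open>ad a\<close>, and
  the first \<open>dim T\<close> iterates of \<open>y t\<close> are independent, because these conditions hold at \<open>t = 0\<close> and at
  \<open>t = 1\<close> respectively. The iterates lie in the centralizer of \<open>y t\<close>, whose dimension is at most
  that of the centralizer of \<open>a\<close>. The elements of \<open>W\<close> complement the centralizer of \<open>a\<close>, so their
  number is the rank of \<open>ad a\<close>.\<close>

theorem torus_dim_le_centralizer: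
  assumes T: "torus T"
  shows "dim T \<le> dim (centralizer a)"
proof -
  obtain B where B: "B \<subseteq> centralizer a" "independent B" "centralizer a \<subseteq> span B"
    "card B = dim (centralizer a)"
    using basis_exists by blast
  obtain B' where B': "B \<subseteq> B'" "independent B'" "UNIV \<subseteq> span B'"
    by (rule maximal_independent_subset_extend[OF subset_UNIV B(2)])
  have fin: "finite B'" using B'(2) by (rule finiteI_independent)
  define W where "W = B' - B"
  have finW: "finite W" using fin by (simp add: W_def)
  have card: "dim UNIV = dim (centralizer a) + card W"
    using B(4) B' fin basis_card_eq_dim[of B' UNIV] card_mono[OF fin B'(1)]
    by (simp add: W_def card_Diff_subset finite_subset)
  have W: "indep_family W (\<lambda>w. \<lbrakk>a, w\<rbrakk>)"
    unfolding indep_family_def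
  proof (intro allI impI)
    fix c assume "(\<Sum>w\<in>W. c w \<odot> \<lbrakk>a, w\<rbrakk>) = 0"
    then have "(\<Sum>w\<in>W. c w \<odot> w) \<in> centralizer a"
      by (simp add: centralizer_def bracket_sum_right bracket_scale_right)
    then have "(\<Sum>w\<in>W. c w \<odot> w) \<in> span (id ` B)" using B(3) by auto
    then obtain d where d: "(\<Sum>w\<in>W. c w \<odot> w) = (\<Sum>b\<in>B. d b \<odot> id b)"
      using span_image_sum[of B] B'(1) fin finite_subset by blast
    let ?e = "\<lambda>b. if b \<in> B then - d b else c b"
    have "(\<Sum>b\<in>B'. ?e b \<odot> b) = (\<Sum>b\<in>W. ?e b \<odot> b) + (\<Sum>b\<in>B. ?e b \<odot> b)"
      unfolding W_def by (rule sum.subset_diff[OF B'(1) fin])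
    also have "(\<Sum>b\<in>W. ?e b \<odot> b) = (\<Sum>w\<in>W. c w \<odot> w)"
      by (rule sum.cong) (auto simp: W_def)
    also have "(\<Sum>b\<in>B. ?e b \<odot> b) = - (\<Sum>b\<in>B. d b \<odot> id b)"
      by (simp add: sum_negf)
    finally have "(\<Sum>b\<in>B'. ?e b \<odot> b) = 0" using d by simp
    then have e0: "?e w = 0" if "w \<in> B'" for w
      using independentD[OF B'(2) fin order.refl, of ?e w] that by blast
    show "\<forall>w\<in>W. c w = 0"
    proof
      show "c w = 0" if "w \<in> W" for w using that e0[of w] by (simp add: W_def)
    qed
  qed
  obtain x where x: "x \<in> T" and ind: "indep_family {..<dim T} (\<lambda>i. sq_pow i x)"
    by (rule torus_generic_element[OF T])
  define y where "y t = a + t \<odot> (x - a)" for t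
  have y_curve: "polynomial_curve y"
    using horner[OF const[of "x - a"], of a] by (simp add: y_def[abs_def])
  have "finite {t. \<not> indep_family W (\<lambda>w. \<lbrakk>y t, w\<rbrakk>)}"
    by (rule indep_family_generic[where ?t0.0 = 0])
      (auto simp: y_def finW W intro: polynomial_curve_bracket_left[OF y_curve, unfolded y_def])
  moreover have "finite {t. \<not> indep_family {..<dim T} (\<lambda>i. sq_pow i (y t))}"
    by (rule indep_family_generic[where ?t0.0 = 1])
      (auto simp: y_def ind intro: polynomial_curve_sq_pow[OF y_curve, unfolded y_def])
  ultimately have "finite ({t. \<not> indep_family W (\<lambda>w. \<lbrakk>y t, w\<rbrakk>)}
      \<union> {t. \<not> indep_family {..<dim T} (\<lambda>i. sq_pow i (y t))})"
    by (rule finite_UnI)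
  from ex_new_if_finite[OF infinite_UNIV_alg_closed this]
  obtain t where t: "indep_family W (\<lambda>w. \<lbrakk>y t, w\<rbrakk>)" "indep_family {..<dim T} (\<lambda>i. sq_pow i (y t))"
    by blast
  have "indep_family ({..<dim T} <+> W) (case_sum (\<lambda>i. sq_pow i (y t)) id)"
    unfolding indep_family_def
  proof (intro allI impI)
    fix c assume "(\<Sum>j\<in>{..<dim T} <+> W. c j \<odot> case_sum (\<lambda>i. sq_pow i (y t)) id j) = 0"
    then have eq: "(\<Sum>i<dim T. c (Inl i) \<odot> sq_pow i (y t)) + (\<Sum>w\<in>W. c (Inr w) \<odot> w) = 0"
      by (simp add: sum.Plus finW)
    have "0 = \<lbrakk>y t, (\<Sum>i<dim T. c (Inl i) \<odot> sq_pow i (y t)) + (\<Sum>w\<in>W. c (Inr w) \<odot> w)\<rbrakk>"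
      by (simp add: eq)
    also have "\<dots> = (\<Sum>w\<in>W. c (Inr w) \<odot> \<lbrakk>y t, w\<rbrakk>)"
      using bracket_sq_pow_same[of 0 "y t"]
      by (simp add: bracket_add_right bracket_sum_right bracket_scale_right)
    finally have W0: "c (Inr w) = 0" if "w \<in> W" for w
      using indep_familyD[OF t(1), of "\<lambda>w. c (Inr w)"] that by simp
    then have "(\<Sum>i<dim T. c (Inl i) \<odot> sq_pow i (y t)) = 0" using eq by simp
    then have "c (Inl i) = 0" if "i < dim T" for i
      using indep_familyD[OF t(2), of "\<lambda>i. c (Inl i)"] that by simp
    then show "\<forall>j\<in>{..<dim T} <+> W. c j = 0" using W0 by auto
  qed
  then have "card ({..<dim T} <+> W) \<le> dim UNIV"
    by (rule indep_family_card_le_dim) (auto simp: finW)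
  then show ?thesis using card finW by (simp add: card_Plus)
qed

lemma toral_rank_eqI:
  assumes "torus H" and "dim (centralizer a) \<le> dim H"
  shows "toral_rank = dim H"
  unfolding toral_rank_def
proof (rule Max_eqI)
  have "{dim T | T. torus T} \<subseteq> {..dim (centralizer a)}"
    using torus_dim_le_centralizer by auto
  then show "finite {dim T | T. torus T}" by (rule finite_subset) simp
  show "n \<le> dim H" if "n \<in> {dim T | T. torus T}" for n
    using that torus_dim_le_centralizer assms(2) by (auto intro: order.trans)
  show "dim H \<in> {dim T | T. torus T}" using assms(1) by blast
qed

end

section \<open>Lie 2-algebras with a split Cartan subalgebra\<close>

context lie2_algebra_alg_closed
begin

lemma of_int_char_2: "(of_int n :: 'k) = (if even n then 0 else 1)"
proof -
  have 2: "(2 :: 'k) = 0" by (rule two_eq_0[OF char_2])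
  show ?thesis
  proof (cases "even n")
    case True
    then show ?thesis by (auto elim!: evenE simp: 2)
  next
    case False
    then show ?thesis by (auto elim!: oddE simp: 2)
  qed
qed

lemma bracket_eq_0_span:
  assumes "\<And>y. y \<in> S \<Longrightarrow> \<lbrakk>x, y\<rbrakk> = 0" "y \<in> span S"
  shows "\<lbrakk>x, y\<rbrakk> = 0"
  using span_minimal[of S "centralizer x"] assms subspace_centralizer[of x]
  by (auto simp: centralizer_def)

end

text \<open>What the reduction of a Chevalley basis modulo 2 and modulo the centre retains: the \<open>E b\<close> stay
  independent, while the \<open>H i\<close> may become dependent. The number \<open>wt b i\<close> is an integer because it
  is the pairing of a root with a coroot; only its parity matters.\<close>

locale root_decomposition = lie2_algebra_alg_closed scale bracket sq
  for scale :: "'k::alg_closed_field \<Rightarrow> 'g::ab_group_add \<Rightarrow> 'g" (infixr \<open>\<odot>\<close> 75)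
    and bracket (\<open>\<lbrakk>_, _\<rbrakk>\<close>) and sq +
  fixes R :: "'r set" and I :: "nat set" and wt :: "'r \<Rightarrow> nat \<Rightarrow> int"
    and E :: "'r \<Rightarrow> 'g" and H :: "nat \<Rightarrow> 'g"
  assumes finite_R: "finite R" and finite_I: "finite I"
    and H_H: "i \<in> I \<Longrightarrow> j \<in> I \<Longrightarrow> \<lbrakk>H i, H j\<rbrakk> = 0"
    and H_E: "i \<in> I \<Longrightarrow> b \<in> R \<Longrightarrow> \<lbrakk>H i, E b\<rbrakk> = of_int (wt b i) \<odot> E b"
    and indep_E: "indep_family R E"
    and spanning: "span (E ` R \<union> H ` I) = UNIV"
    and centre_trivial: "centre = {0}"
    and odd_wt: "b \<in> R \<Longrightarrow> \<exists>i\<in>I. odd (wt b i)"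
begin

definition root_value :: "(nat \<Rightarrow> 'k) \<Rightarrow> 'r \<Rightarrow> 'k" where
  "root_value c b = (\<Sum>i\<in>I. c i * of_int (wt b i))"

definition cartan_elt :: "(nat \<Rightarrow> 'k) \<Rightarrow> 'g" where
  "cartan_elt c = (\<Sum>i\<in>I. c i \<odot> H i)"

lemma cartan_elt_in_span: "cartan_elt c \<in> span (H ` I)"
  unfolding cartan_elt_def by (intro span_sum span_scale span_base) auto

lemma cartan_elt_cases:
  assumes "x \<in> span (H ` I)"
  obtains c where "x = cartan_elt c"
  unfolding cartan_elt_def by (rule span_image_sum[OF finite_I assms])

lemma cartan_elt_E: "b \<in> R \<Longrightarrow> \<lbrakk>cartan_elt c, E b\<rbrakk> = root_value c b \<odot> E b"
  by (simp add: cartan_elt_def root_value_def bracket_sum_left bracket_scale_left H_E scale_sum_left)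

lemma cartan_elt_H: "i \<in> I \<Longrightarrow> \<lbrakk>cartan_elt c, H i\<rbrakk> = 0"
  by (simp add: cartan_elt_def bracket_sum_left bracket_scale_left H_H)

lemma cartan_commute:
  assumes "x \<in> span (H ` I)" "y \<in> span (H ` I)"
  shows "\<lbrakk>x, y\<rbrakk> = 0"
proof -
  obtain c where "x = cartan_elt c" using assms(1) by (rule cartan_elt_cases)
  then show ?thesis by (intro bracket_eq_0_span[OF _ assms(2)]) (auto simp: cartan_elt_H)
qed

lemma E_nonzero:
  assumes "b \<in> R"
  shows "E b \<noteq> 0"
proof
  assume "E b = 0"
  then have "dependent (E ` R)" using assms by (intro dependent_zero) (metis imageI)
  then show False using indep_E finite_R by (simp add: indep_family_iff)
qed

lemma eq_0_if_central:
  assumes "\<And>b. b \<in> R \<Longrightarrow> \<lbrakk>x, E b\<rbrakk> = 0" "\<And>i. i \<in> I \<Longrightarrow> \<lbrakk>x, H i\<rbrakk> = 0"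
  shows "x = 0"
proof -
  have "\<lbrakk>x, y\<rbrakk> = 0" for y
    by (rule bracket_eq_0_span[of "E ` R \<union> H ` I"]) (use assms spanning in auto)
  then have "x \<in> centre" by (simp add: centre_def)
  then show ?thesis using centre_trivial by simp
qed

text \<open>Linear relations between the \<open>H i\<close> are exactly the solutions of a linear system over the field,
  since an element on which all roots vanish is central.\<close>

lemma cartan_elt_eq_0_iff: "cartan_elt c = 0 \<longleftrightarrow> (\<forall>b\<in>R. root_value c b = 0)"
proof
  assume 0: "cartan_elt c = 0"
  show "\<forall>b\<in>R. root_value c b = 0"
  proof
    fix b assume b: "b \<in> R"
    show "root_value c b = 0" using cartan_elt_E[OF b, of c] E_nonzero[OF b] by (simp add: 0)
  qed
next
  assume r: "\<forall>b\<in>R. root_value c b = 0"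
  show "cartan_elt c = 0"
    by (rule eq_0_if_central) (simp_all add: cartan_elt_E cartan_elt_H r)
qed

text \<open>The integers \<open>n\<close> and \<open>n^2\<close> have the same parity, so \<open>(ad (H i))^2 = ad (H i)\<close>, and \<open>ad\<close> is
  injective.\<close>

lemma sq_H: "i \<in> I \<Longrightarrow> sq (H i) = H i"
proof -
  assume i: "i \<in> I"
  have "sq (H i) + H i = 0"
  proof (rule eq_0_if_central)
    fix b assume b: "b \<in> R"
    show "\<lbrakk>sq (H i) + H i, E b\<rbrakk> = 0"
      using i b by (simp add: bracket_add_left ad_sq H_E bracket_scale_right of_int_char_2)
  next
    fix j assume "j \<in> I"
    then show "\<lbrakk>sq (H i) + H i, H j\<rbrakk> = 0"
      using i by (simp add: bracket_add_left ad_sq H_H)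
  qed
  then have "sq (H i) + (H i + H i) = H i" by (simp only: add.assoc[symmetric]) simp
  then show ?thesis by simp
qed

lemma sq_cartan_elt: "sq (cartan_elt c) = cartan_elt (\<lambda>i. (c i)\<^sup>2)"
  unfolding cartan_elt_def by (subst sq_sum_commuting) (simp_all add: finite_I H_H sq_H)

text \<open>On the span of the toral elements \<open>H i\<close> the 2-map is \<open>c \<mapsto> c^2\<close> on coefficients: surjective as the
  field is perfect, and injective since \<open>sq x = 0\<close> forces \<open>(ad x)^2 = 0\<close>, so that all roots vanish
  on \<open>x\<close>.\<close>

lemma torus_cartan: "torus (span (H ` I))"
proof -
  let ?C = "span (H ` I)"
  have "sq ` ?C = ?C"
  proof (intro equalityI subsetI)
    fix x assume "x \<in> sq ` ?C"
    then show "x \<in> ?C" by (auto elim!: cartan_elt_cases simp: sq_cartan_elt cartan_elt_in_span)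
  next
    fix x assume "x \<in> ?C"
    then obtain c where x: "x = cartan_elt c" by (rule cartan_elt_cases)
    have "\<exists>d. \<forall>i. (d i)\<^sup>2 = c i" by (intro choice allI square_root_exists)
    then obtain d where "\<And>i. (d i)\<^sup>2 = c i" by blast
    then have "x = sq (cartan_elt d)" by (simp add: x sq_cartan_elt)
    then show "x \<in> sq ` ?C" using cartan_elt_in_span by blast
  qed
  moreover have "inj_on sq ?C"
  proof (rule inj_onI)
    fix x y assume xy: "x \<in> ?C" "y \<in> ?C" "sq x = sq y"
    obtain c where c: "x + y = cartan_elt c"
      using span_add[OF xy(1,2)] by (rule cartan_elt_cases)
    have "sq (x + y) = 0" using xy cartan_commute by (simp add: sq_add)
    then have "root_value c b * root_value c b = 0" if "b \<in> R" for b
      using that ad_sq[of "x + y" "E b"] E_nonzero[OF that]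
      by (simp add: c cartan_elt_E bracket_scale_right)
    then have "x + y = 0" by (simp add: c cartan_elt_eq_0_iff)
    then have "x + (y + y) = y" by (simp only: add.assoc[symmetric]) simp
    then show "x = y" by simp
  qed
  ultimately show ?thesis
    using cartan_commute
    by (auto simp: torus_def subalgebra_def bij_betw_def span_zero)
qed

text \<open>No root vanishes identically, by the parity assumption; hence the point \<open>(t^i)\<close> of the moment
  curve avoids all root hyperplanes for all but finitely many \<open>t\<close>.\<close>

lemma regular_elt_exists: "\<exists>c. \<forall>b\<in>R. root_value c b \<noteq> 0"
proof -
  define p where "p b = (\<Sum>i\<in>I. monom (of_int (wt b i) :: 'k) i)" for b
  have p0: "p b \<noteq> 0" if b: "b \<in> R" for b
  proof -
    obtain i where i: "i \<in> I" "odd (wt b i)" using odd_wt[OF b] by blast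
    have "coeff (p b) i = (\<Sum>j\<in>I. if j = i then of_int (wt b i) else 0)"
      unfolding p_def coeff_sum by (rule sum.cong) (auto simp: coeff_monom)
    also have "\<dots> = 1" using i finite_I by (simp add: of_int_char_2)
    finally show ?thesis by auto
  qed
  have "finite (\<Union>b\<in>R. {t. poly (p b) t = 0})"
    using finite_R p0 poly_roots_finite by blast
  from ex_new_if_finite[OF infinite_UNIV_alg_closed this]
  obtain t where "\<forall>b\<in>R. poly (p b) t \<noteq> 0" by blast
  moreover have "poly (p b) t = root_value (\<lambda>i. t ^ i) b" for b
    by (simp add: p_def root_value_def poly_sum poly_monom mult.commute)
  ultimately show ?thesis by auto
qed

lemma centralizer_regular:
  assumes "\<forall>b\<in>R. root_value c b \<noteq> 0"
  shows "centralizer (cartan_elt c) \<subseteq> span (H ` I)"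
proof
  fix z assume "z \<in> centralizer (cartan_elt c)"
  then have z: "\<lbrakk>cartan_elt c, z\<rbrakk> = 0" by (simp add: centralizer_def)
  have "z \<in> span (E ` R \<union> H ` I)" using spanning by simp
  then obtain x y where xy: "x \<in> span (E ` R)" "y \<in> span (H ` I)" "z = x + y"
    by (auto simp: span_Un)
  obtain d where d: "x = (\<Sum>b\<in>R. d b \<odot> E b)" using xy(1) by (rule span_image_sum[OF finite_R])
  have "(\<Sum>b\<in>R. (d b * root_value c b) \<odot> E b) = \<lbrakk>cartan_elt c, x\<rbrakk>"
    by (simp add: d bracket_sum_right bracket_scale_right cartan_elt_E)
  also have "\<dots> = 0"
    using z xy(3) cartan_commute[OF cartan_elt_in_span xy(2)] by (simp add: bracket_add_right)
  finally have "d b * root_value c b = 0" if "b \<in> R" for b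
    using indep_familyD[OF indep_E, of "\<lambda>b. d b * root_value c b"] that by blast
  then have "x = 0" using assms by (simp add: d)
  then show "z \<in> span (H ` I)" using xy by simp
qed

theorem toral_rank_eq_dim_cartan: "toral_rank = dim (span (H ` I))"
proof -
  obtain c where "\<forall>b\<in>R. root_value c b \<noteq> 0" using regular_elt_exists by blast
  then show ?thesis
    by (intro toral_rank_eqI[OF torus_cartan dim_subset[OF centralizer_regular]])
qed

text \<open>The set \<open>J\<close> indexes a basis of the span of the \<open>H i\<close>: there is no relation supported on \<open>J\<close>, and
  for each \<open>k\<close> outside \<open>J\<close> a relation expresses \<open>H k\<close> in terms of that basis.\<close>

lemma toral_rank_eq_card:
  assumes J: "J \<subseteq> I"
    and ind: "\<And>c. (\<And>i. i \<in> I - J \<Longrightarrow> c i = 0) \<Longrightarrow> (\<And>b. b \<in> R \<Longrightarrow> root_value c b = 0)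
      \<Longrightarrow> \<forall>i\<in>J. c i = 0"
    and dep: "\<And>k. k \<in> I - J \<Longrightarrow> \<exists>c. (\<forall>i\<in>I - J. c i = (if i = k then 1 else 0)) \<and>
      (\<forall>b\<in>R. root_value c b = 0)"
  shows "toral_rank = card J"
proof -
  have fin: "finite J" using J finite_I by (rule finite_subset)
  have "indep_family J H"
    unfolding indep_family_def
  proof (intro allI impI)
    fix c assume c: "(\<Sum>i\<in>J. c i \<odot> H i) = 0"
    let ?c = "\<lambda>i. if i \<in> J then c i else 0"
    have "cartan_elt ?c = (\<Sum>i\<in>J. ?c i \<odot> H i)"
      unfolding cartan_elt_def using J finite_I by (intro sum.mono_neutral_right) auto
    then have "cartan_elt ?c = 0" using c by simp
    then have "\<forall>i\<in>J. ?c i = 0" using ind[of ?c] by (simp add: cartan_elt_eq_0_iff)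
    then show "\<forall>i\<in>J. c i = 0" by simp
  qed
  then have card: "dim (span (H ` J)) = card J"
    using fin dim_span_eq_card_independent by (simp add: indep_family_iff card_image)
  have "H k \<in> span (H ` J)" if k: "k \<in> I" for k
  proof (cases "k \<in> J")
    case False
    obtain c where c: "\<forall>i\<in>I - J. c i = (if i = k then 1 else 0)" "\<forall>b\<in>R. root_value c b = 0"
      using dep[of k] k False by blast
    have "0 = cartan_elt c" using c(2) cartan_elt_eq_0_iff by simp
    also have "\<dots> = (\<Sum>i\<in>I - J. c i \<odot> H i) + (\<Sum>i\<in>J. c i \<odot> H i)"
      unfolding cartan_elt_def by (rule sum.subset_diff[OF J finite_I])
    also have "(\<Sum>i\<in>I - J. c i \<odot> H i) = (\<Sum>i\<in>I - J. if i = k then H k else 0)"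
      using c(1) by (intro sum.cong) auto
    also have "\<dots> = H k" using k False finite_I by simp
    finally have "H k = - (\<Sum>i\<in>J. c i \<odot> H i)" by (simp add: eq_neg_iff_add_eq_0)
    then show ?thesis by (simp only:) (intro span_neg span_sum span_scale span_base imageI)
  qed (auto intro: span_base)
  then have "span (H ` I) = span (H ` J)"
    using J by (intro span_subspace[symmetric] equalityI span_mono span_minimal) auto
  then show ?thesis using card toral_rank_eq_dim_cartan by simp
qed

end

section \<open>Parity of the pairings of roots with simple coroots\<close>

lemma even_symmetric_double_sum:
  fixes f :: "'a \<Rightarrow> 'a \<Rightarrow> int"
  assumes "finite S" "\<And>i j. i \<in> S \<Longrightarrow> j \<in> S \<Longrightarrow> f i j = f j i" "\<And>i. i \<in> S \<Longrightarrow> even (f i i)"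
  shows "even (\<Sum>i\<in>S. \<Sum>j\<in>S. f i j)"
  using assms
proof (induction S rule: finite_induct)
  case (insert x S)
  have "(\<Sum>i\<in>S. f i x) = (\<Sum>j\<in>S. f x j)"
    using insert.prems by (intro sum.cong) auto
  then have "(\<Sum>i\<in>insert x S. \<Sum>j\<in>insert x S. f i j)
      = f x x + 2 * (\<Sum>j\<in>S. f x j) + (\<Sum>i\<in>S. \<Sum>j\<in>S. f i j)"
    using insert.hyps by (simp add: sum.distrib)
  then show ?case using insert by simp
qed simp

text \<open>Integrality of the coroots is a theorem about root systems with a base; a Chevalley basis provides
  it directly, through the bracket of opposite root vectors.\<close>

locale integral_based_root_system = based_root_system \<Phi> X \<alpha>
  for \<Phi> :: "'r::euclidean_space set" and X \<alpha> +
  assumes coroot_integral: "a \<in> \<Phi> \<Longrightarrow>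
    \<exists>m::nat \<Rightarrow> int. coroot a = (\<Sum>i = 1..rank_of X. of_int (m i) *\<^sub>R coroot (\<alpha> i))"
begin

definition pairing :: "'r \<Rightarrow> nat \<Rightarrow> int" where
  "pairing b i = \<lfloor>b \<bullet> coroot (\<alpha> i)\<rfloor>"

lemma simple_root: "i \<in> {1..rank_of X} \<Longrightarrow> \<alpha> i \<in> \<Phi>"
  using simple_roots by auto

lemma of_int_pairing:
  "b \<in> \<Phi> \<Longrightarrow> i \<in> {1..rank_of X} \<Longrightarrow> of_int (pairing b i) = b \<bullet> coroot (\<alpha> i)"
  using integrality[OF simple_root] by (auto simp: pairing_def elim!: Ints_cases)

lemma pairing_simple:
  assumes "j \<in> {1..rank_of X}" "i \<in> {1..rank_of X}"
  shows "pairing (\<alpha> j) i = cartan_matrix X j i"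
  using assms by (simp add: pairing_def cartan)

lemma root_integral:
  assumes "b \<in> \<Phi>"
  obtains m :: "nat \<Rightarrow> int" where "b = (\<Sum>i = 1..rank_of X. of_int (m i) *\<^sub>R \<alpha> i)"
proof -
  obtain m :: "nat \<Rightarrow> nat" where
    "b = (\<Sum>i = 1..rank_of X. real (m i) *\<^sub>R \<alpha> i) \<or> b = - (\<Sum>i = 1..rank_of X. real (m i) *\<^sub>R \<alpha> i)"
    using base[OF assms] by blast
  then show ?thesis
    using that[of "\<lambda>i. int (m i)"] that[of "\<lambda>i. - int (m i)"] by (auto simp: sum_negf)
qed

lemma pairing_root:
  assumes "b = (\<Sum>j = 1..rank_of X. of_int (m j) *\<^sub>R \<alpha> j)" "b \<in> \<Phi>" "i \<in> {1..rank_of X}"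
  shows "pairing b i = (\<Sum>j = 1..rank_of X. m j * cartan_matrix X j i)"
proof -
  have "real_of_int (pairing b i) = b \<bullet> coroot (\<alpha> i)" by (rule of_int_pairing[OF assms(2,3)])
  also have "\<dots> = of_int (\<Sum>j = 1..rank_of X. m j * cartan_matrix X j i)"
    unfolding assms(1) using assms(3) by (simp add: inner_sum_left cartan)
  finally show ?thesis by (simp only: of_int_eq_iff)
qed

lemma coroot_inner: "a \<bullet> coroot b = 2 * (a \<bullet> b) / (b \<bullet> b)"
  by (simp add: coroot_def)

lemma simple_inner_pos: "i \<in> {1..rank_of X} \<Longrightarrow> \<alpha> i \<bullet> \<alpha> i > 0"
  using simple_root[of i] zero_not_root by auto

lemma cartan_inner:
  assumes "i \<in> {1..rank_of X}" "j \<in> {1..rank_of X}"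
  shows "2 * (\<alpha> i \<bullet> \<alpha> j) = of_int (cartan_matrix X i j) * (\<alpha> j \<bullet> \<alpha> j)"
  using cartan[OF assms] simple_inner_pos[OF assms(2)] by (simp add: coroot_inner field_simps)

lemma simple_inner_eq:
  assumes "i \<in> {1..rank_of X}" "j \<in> {1..rank_of X}"
    and "cartan_matrix X i j = cartan_matrix X j i" "cartan_matrix X i j \<noteq> 0"
  shows "\<alpha> i \<bullet> \<alpha> i = \<alpha> j \<bullet> \<alpha> j"
  using cartan_inner[OF assms(1,2)] cartan_inner[OF assms(2,1)] assms(3,4)
  by (simp add: inner_commute)

lemma root_nonzero: "a \<in> \<Phi> \<Longrightarrow> a \<bullet> a > 0"
  using zero_not_root by auto

text \<open>When all simple roots have the same square length \<open>c\<close>, the square lengths of all vectors of the root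
  lattice are integral multiples of \<open>c\<close>. Applying this to a root \<open>a\<close> and, rescaled, to its coroot gives \<open>(a, a) = c\<close>. If all
  pairings of \<open>a\<close> with simple coroots were even, then \<open>(a, \<alpha> i)\<close> would be a multiple of \<open>c\<close>, and
  \<open>a\<close> would be orthogonal to \<open>\<alpha> i\<close> or equal to \<open>\<plusminus>\<alpha> i\<close>. Orthogonality to all simple roots is
  impossible, and \<open>\<plusminus>\<alpha> i\<close> pairs oddly with a neighbour of \<open>\<alpha> i\<close>.\<close>

lemma odd_pairing_simply_laced:
  assumes len: "\<And>i. i \<in> {1..rank_of X} \<Longrightarrow> \<alpha> i \<bullet> \<alpha> i = c"
    and nbr: "\<And>i. i \<in> {1..rank_of X} \<Longrightarrow> \<exists>j\<in>{1..rank_of X}. odd (cartan_matrix X i j)"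
    and a: "a \<in> \<Phi>"
  shows "\<exists>i\<in>{1..rank_of X}. odd (pairing a i)"
proof (rule ccontr)
  let ?I = "{1..rank_of X}"
  assume "\<not> ?thesis"
  then have even: "even (pairing a i)" if "i \<in> ?I" for i using that by blast
  obtain m where m: "a = (\<Sum>i\<in>?I. of_int (m i) *\<^sub>R \<alpha> i)" by (rule root_integral[OF a])
  have "?I \<noteq> {}" using m root_nonzero[OF a] by (intro notI) simp
  then have c: "c > 0" using len simple_inner_pos by fastforce
  have inn: "\<alpha> i \<bullet> \<alpha> j = (c / 2) * of_int (cartan_matrix X i j)" if "i \<in> ?I" "j \<in> ?I" for i j
    using cartan_inner[OF that] len[OF that(2)] by (simp add: field_simps)
  have sym: "cartan_matrix X i j = cartan_matrix X j i" if "i \<in> ?I" "j \<in> ?I" for i j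
    using inn[OF that] inn[OF that(2,1)] c by (simp add: inner_commute)
  have lattice: "\<exists>q::int. v \<bullet> v = c * of_int q" if v: "v = (\<Sum>i\<in>?I. of_int (k i) *\<^sub>R \<alpha> i)" for v k
  proof -
    let ?f = "\<lambda>i j. k i * k j * cartan_matrix X i j"
    have "even (\<Sum>i\<in>?I. \<Sum>j\<in>?I. ?f i j)"
      by (rule even_symmetric_double_sum) (auto simp: sym, simp add: cartan_matrix_def)
    then obtain q where q: "(\<Sum>i\<in>?I. \<Sum>j\<in>?I. ?f i j) = 2 * q" by (rule evenE)
    have "v \<bullet> v = (\<Sum>i\<in>?I. \<Sum>j\<in>?I. (c / 2) * of_int (?f i j))"
      unfolding v inner_sum_left inner_sum_right
      by (intro sum.cong) (auto simp: inn intro: sym)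
    also have "\<dots> = (c / 2) * of_int (\<Sum>i\<in>?I. \<Sum>j\<in>?I. ?f i j)"
      by (simp add: sum_distrib_left)
    also have "\<dots> = c * of_int q" unfolding q by simp
    finally show ?thesis by blast
  qed
  have aa: "a \<bullet> a = c"
  proof -
    obtain q :: int where q: "a \<bullet> a = c * of_int q" using lattice[OF m] by blast
    obtain k :: "nat \<Rightarrow> int" where k: "coroot a = (\<Sum>i\<in>?I. of_int (k i) *\<^sub>R coroot (\<alpha> i))"
      using coroot_integral[OF a] by blast
    define u where "u = (\<Sum>i\<in>?I. of_int (k i) *\<^sub>R \<alpha> i)"
    obtain r :: int where r: "u \<bullet> u = c * of_int r" using lattice[OF u_def] by blast
    have "coroot a = (2 / c) *\<^sub>R u"
      unfolding k u_def scaleR_sum_right by (rule sum.cong) (simp_all add: coroot_def len)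
    then have "coroot a \<bullet> coroot a = 4 / c * of_int r"
      using c by (simp add: r power2_eq_square)
    moreover have "coroot a \<bullet> coroot a = 4 / (c * of_int q)"
      using root_nonzero[OF a] by (simp add: coroot_def q)
    moreover have "(of_int q :: real) \<noteq> 0" using root_nonzero[OF a] q by auto
    ultimately have "(of_int q * of_int r :: real) = 1" using c by (simp add: field_simps)
    then have "q * r = 1" by (simp flip: of_int_mult)
    moreover have "q > 0" using root_nonzero[OF a] q c by (simp add: zero_less_mult_iff)
    ultimately have "q = 1" by (auto simp: zmult_eq_1_iff)
    then show ?thesis using q by simp
  qed
  have cases: "a \<bullet> \<alpha> i = 0 \<or> a = \<alpha> i \<or> a = - \<alpha> i" if i: "i \<in> ?I" for i
  proof -
    obtain k where k: "pairing a i = 2 * k" using even[OF i] by (rule evenE)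
    have ai: "a \<bullet> \<alpha> i = c * of_int k"
      using of_int_pairing[OF a i] c by (simp add: k coroot_inner len[OF i] field_simps)
    have plus: "(a + \<alpha> i) \<bullet> (a + \<alpha> i) = 2 * c * (1 + of_int k)"
      by (simp add: inner_add_left inner_add_right aa len[OF i] ai inner_commute[of "\<alpha> i" a]
          algebra_simps)
    have minus: "(a - \<alpha> i) \<bullet> (a - \<alpha> i) = 2 * c * (1 - of_int k)"
      by (simp add: inner_diff_left inner_diff_right aa len[OF i] ai inner_commute[of "\<alpha> i" a]
          algebra_simps)
    have "(0::real) \<le> 1 + of_int k" "(0::real) \<le> 1 - of_int k"
      using inner_ge_zero[of "a + \<alpha> i"] inner_ge_zero[of "a - \<alpha> i"] c
      unfolding plus minus by (simp_all add: zero_le_mult_iff)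
    then have "k = 0 \<or> k = 1 \<or> k = - 1" by linarith
    then show ?thesis
    proof (elim disjE)
      assume "k = 1"
      then have "(a - \<alpha> i) \<bullet> (a - \<alpha> i) = 0" using minus by simp
      then have "a - \<alpha> i = 0" by (simp only: inner_eq_zero_iff)
      then show ?thesis by simp
    next
      assume "k = - 1"
      then have "(a + \<alpha> i) \<bullet> (a + \<alpha> i) = 0" using plus by simp
      then have "a + \<alpha> i = 0" by (simp only: inner_eq_zero_iff)
      then show ?thesis by (simp add: eq_neg_iff_add_eq_0)
    qed (use ai in simp)
  qed
  show False
  proof (cases "\<exists>i\<in>?I. a = \<alpha> i \<or> a = - \<alpha> i")
    case True
    then obtain i where i: "i \<in> ?I" "a = \<alpha> i \<or> a = - \<alpha> i" by blast
    obtain j where j: "j \<in> ?I" "odd (cartan_matrix X i j)" using nbr[OF i(1)] by blast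
    have "real_of_int (pairing a j) = of_int (cartan_matrix X i j)
        \<or> real_of_int (pairing a j) = of_int (- cartan_matrix X i j)"
      using i(2) of_int_pairing[OF a j(1)] cartan[OF i(1) j(1)] by auto
    then have "pairing a j = cartan_matrix X i j \<or> pairing a j = - cartan_matrix X i j"
      by (simp only: of_int_eq_iff)
    then show False using even[OF j(1)] j(2) by auto
  next
    case False
    then have "a \<bullet> \<alpha> i = 0" if "i \<in> ?I" for i using cases[OF that] that by blast
    then have "a \<bullet> (\<Sum>i\<in>?I. of_int (m i) *\<^sub>R \<alpha> i) = 0"
      unfolding inner_sum_right by (intro sum.neutral) simp
    then show False using root_nonzero[OF a] m by simp
  qed
qed

text \<open>The Cartan matrix is invertible modulo 2, so even pairings make \<open>a\<close> twice a lattice vector,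
  whence \<open>(a, a) \<ge> 4 c\<close> for the square length \<open>c\<close> of the short simple root. This contradicts the
  integrality of the coroot of \<open>a\<close>, which gives \<open>(a, a) \<le> 3 c\<close>; in terms of the integers \<open>q\<close> and
  \<open>r\<close> in the two square lengths the contradiction is \<open>4 q r = 3\<close>.\<close>

lemma odd_pairing_G2:
  assumes X: "X = Type_G2" and a: "a \<in> \<Phi>"
  shows "\<exists>i\<in>{1..rank_of X}. odd (pairing a i)"
proof (rule ccontr)
  have I: "{1..rank_of X} = {1, 2}" using X by auto
  then have in_I: "1 \<in> {1..rank_of X}" "2 \<in> {1..rank_of X}" by auto
  have cart: "cartan_matrix X 1 1 = 2" "cartan_matrix X 2 2 = 2"
    "cartan_matrix X 1 2 = - 1" "cartan_matrix X 2 1 = - 3"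
    using X by (auto simp: cartan_matrix_def)
  assume "\<not> ?thesis"
  then have even: "even (pairing a 1)" "even (pairing a 2)" using I by auto
  define c where "c = \<alpha> 1 \<bullet> \<alpha> 1"
  have c: "c > 0" using simple_inner_pos[OF in_I(1)] by (simp add: c_def)
  have inn: "\<alpha> 1 \<bullet> \<alpha> 2 = - (3 / 2 * c)" "\<alpha> 2 \<bullet> \<alpha> 1 = - (3 / 2 * c)" "\<alpha> 2 \<bullet> \<alpha> 2 = 3 * c"
    using cartan_inner[OF in_I(1,2)] cartan_inner[OF in_I(2,1)]
    unfolding cart c_def inner_commute[of "\<alpha> 2" "\<alpha> 1"] by simp_all
  obtain m where m: "a = (\<Sum>i = 1..rank_of X. of_int (m i) *\<^sub>R \<alpha> i)"
    by (rule root_integral[OF a])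
  have "pairing a 1 = 2 * m 1 - 3 * m 2" "pairing a 2 = 2 * m 2 - m 1"
    using pairing_root[OF m a in_I(1)] pairing_root[OF m a in_I(2)] unfolding I
    by (simp_all add: cart cart[unfolded One_nat_def])
  then have "even (m 1)" "even (m 2)" using even by presburger+
  then obtain s t where st: "m 1 = 2 * s" "m 2 = 2 * t" by (auto elim!: evenE)
  have "a = of_int (2 * s) *\<^sub>R \<alpha> 1 + of_int (2 * t) *\<^sub>R \<alpha> 2"
    using m unfolding I by (simp add: st st[unfolded One_nat_def])
  then have "a \<bullet> a = 4 * c * of_int (s * s - 3 * s * t + 3 * t * t)"
    by (simp add: inner_add_left inner_add_right inn[unfolded One_nat_def]
        c_def[symmetric, unfolded One_nat_def] algebra_simps)
  then obtain q where q: "a \<bullet> a = 4 * c * of_int q" by blast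
  obtain k :: "nat \<Rightarrow> int" where "coroot a = (\<Sum>i = 1..rank_of X. of_int (k i) *\<^sub>R coroot (\<alpha> i))"
    using coroot_integral[OF a] by blast
  then have "coroot a = of_int (k 1) *\<^sub>R coroot (\<alpha> 1) + of_int (k 2) *\<^sub>R coroot (\<alpha> 2)"
    unfolding I by simp
  also have "\<dots> = (2 / (3 * c)) *\<^sub>R (of_int (3 * k 1) *\<^sub>R \<alpha> 1 + of_int (k 2) *\<^sub>R \<alpha> 2)"
    using c by (simp add: coroot_def inn[unfolded One_nat_def]
        c_def[symmetric, unfolded One_nat_def] scaleR_add_right
        mult.commute[of 2])
  finally have "coroot a \<bullet> coroot a
      = (2 / (3 * c))\<^sup>2 * (3 * c * of_int (3 * k 1 * k 1 - 3 * k 1 * k 2 + k 2 * k 2))"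
    by (simp add: inner_add_left inner_add_right inn[unfolded One_nat_def]
        c_def[symmetric, unfolded One_nat_def] power2_eq_square algebra_simps)
  then obtain r where "coroot a \<bullet> coroot a = (2 / (3 * c))\<^sup>2 * (3 * c * of_int r)" by blast
  moreover have "coroot a \<bullet> coroot a = 4 / (4 * c * of_int q)"
    using root_nonzero[OF a] by (simp add: coroot_def q)
  moreover have "(of_int q :: real) \<noteq> 0" using root_nonzero[OF a] q by auto
  ultimately have "(4 * (of_int q * of_int r) :: real) = 3"
    using c by (simp add: field_simps power2_eq_square)
  then have "real_of_int (4 * (q * r)) = of_int 3" by simp
  then have "4 * (q * r) = 3" by (simp only: of_int_eq_iff)
  then show False by presburger
qed

end

section \<open>The kernel of the Cartan matrix modulo 2\<close>

text \<open>The condition at \<open>j\<close> says that the simple root \<open>\<alpha> j\<close> vanishes on the combination of simple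
  coroots with coefficients \<open>c\<close>.\<close>

definition cartan_kernel :: "root_type \<Rightarrow> (nat \<Rightarrow> 'k::field) \<Rightarrow> bool" where
  "cartan_kernel X c \<longleftrightarrow>
     (\<forall>j\<in>{1..rank_of X}. (\<Sum>i = 1..rank_of X. c i * of_int (cartan_matrix X j i)) = 0)"

lemma add_eq_0_iff_char_2:
  assumes "CHAR('k) = 2"
  shows "x + y = 0 \<longleftrightarrow> x = (y :: 'k::field)"
proof -
  have "y + y = 2 * y" by simp
  then have "y + y = 0" using two_eq_0[OF assms] by simp
  then show ?thesis by (metis add_right_cancel)
qed

text \<open>Extending the coefficients by 0 to the positions next to the ends of the Dynkin diagram gives the
  end vertices of a path the same equation as the inner ones.\<close>

definition truncate :: "nat \<Rightarrow> (nat \<Rightarrow> 'k::zero) \<Rightarrow> nat \<Rightarrow> 'k" where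
  "truncate n c i = (if i \<in> {1..n} then c i else 0)"

lemma sum_two_points:
  fixes c :: "nat \<Rightarrow> 'k::comm_monoid_add"
  assumes "a \<noteq> b"
  shows "(\<Sum>i = 1..n. if i = a \<or> i = b then c i else 0) = truncate n c a + truncate n c b"
proof -
  have "(\<Sum>i = 1..n. if i = a \<or> i = b then c i else 0)
      = (\<Sum>i = 1..n. (if i = a then c i else 0) + (if i = b then c i else 0))"
    using assms by (intro sum.cong) auto
  then show ?thesis by (simp add: sum.distrib truncate_def)
qed

lemma cartan_term_char_2:
  assumes "CHAR('k) = 2" "cartan_mult X j i = 1"
  shows "(c i :: 'k::field) * of_int (cartan_matrix X j i)
    = (if i \<noteq> j \<and> (dynkin_edge X i j \<or> dynkin_edge X j i) then c i else 0)"
  using assms(2) two_eq_0[OF assms(1)] add_eq_0_iff_char_2[OF assms(1), of "c i" "- c i"]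
  by (auto simp: cartan_matrix_def)

lemma cartan_kernel_A:
  assumes "CHAR('k) = 2"
  shows "cartan_kernel (Type_A n) (c :: nat \<Rightarrow> 'k::field) \<longleftrightarrow>
    (\<forall>j\<in>{1..n}. truncate n c (j - 1) = truncate n c (j + 1))"
proof -
  have "(\<Sum>i = 1..n. c i * of_int (cartan_matrix (Type_A n) j i))
      = truncate n c (j - 1) + truncate n c (j + 1)" if "j \<in> {1..n}" for j
  proof -
    have "(\<Sum>i = 1..n. c i * of_int (cartan_matrix (Type_A n) j i))
        = (\<Sum>i = 1..n. if i = j - 1 \<or> i = j + 1 then c i else 0)"
      using that by (intro sum.cong refl) (subst cartan_term_char_2[OF assms], auto)
    then show ?thesis using sum_two_points[where a = "j - 1" and b = "j + 1" and c = c and n = n] by simp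
  qed
  then show ?thesis by (simp add: cartan_kernel_def add_eq_0_iff_char_2[OF assms])
qed

lemma cartan_kernel_D:
  assumes "CHAR('k) = 2" "n \<ge> 3"
  shows "cartan_kernel (Type_D n) (c :: nat \<Rightarrow> 'k::field) \<longleftrightarrow>
    (\<forall>j\<in>{1..n - 3}. truncate n c (j - 1) = truncate n c (j + 1)) \<and>
    truncate n c (n - 3) + c (n - 1) + c n = 0 \<and> c (n - 2) = 0"
    (is "?L \<longleftrightarrow> (\<forall>j\<in>_. ?row j) \<and> ?last \<and> ?tip")
proof -
  let ?S = "\<lambda>j. \<Sum>i = 1..n. c i * of_int (cartan_matrix (Type_D n) j i)"
  have S: "?S j = (\<Sum>i = 1..n. if i \<noteq> j \<and> (dynkin_edge (Type_D n) i j \<or> dynkin_edge (Type_D n) j i)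
      then c i else 0)" for j
    by (intro sum.cong refl) (subst cartan_term_char_2[OF assms(1)], auto)
  have row: "?S j = truncate n c (j - 1) + truncate n c (j + 1)" if j: "j \<in> {1..n - 3}" for j
  proof -
    have "?S j = (\<Sum>i = 1..n. if i = j - 1 \<or> i = j + 1 then c i else 0)"
      unfolding S
    proof (intro sum.cong refl if_cong)
      fix i assume "i \<in> {1..n}"
      moreover obtain k where "j = Suc k" using j by (cases j) auto
      moreover obtain m where "n = m + 3" using assms(2) le_Suc_ex[of 3 n] by auto
      ultimately show "(i \<noteq> j \<and> (dynkin_edge (Type_D n) i j \<or> dynkin_edge (Type_D n) j i))
          = (i = j - 1 \<or> i = j + 1)"
        using j by auto
    qed
    then show ?thesis using sum_two_points[where a = "j - 1" and b = "j + 1" and c = c and n = n] by simp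
  qed
  have last: "?S (n - 2) = truncate n c (n - 3) + c (n - 1) + c n"
  proof -
    have "?S (n - 2) = (\<Sum>i = 1..n. (if i = n - 3 \<or> i = n - 1 then c i else 0)
        + (if i = n then c i else 0))"
      unfolding S using assms(2) by (intro sum.cong refl) auto
    also have "\<dots> = (\<Sum>i = 1..n. if i = n - 3 \<or> i = n - 1 then c i else 0) + c n"
      using assms(2) by (subst sum.distrib) simp
    also have "(\<Sum>i = 1..n. if i = n - 3 \<or> i = n - 1 then c i else 0)
        = truncate n c (n - 3) + truncate n c (n - 1)"
      using assms(2) by (intro sum_two_points) simp
    also have "truncate n c (n - 1) = c (n - 1)" using assms(2) by (simp add: truncate_def)
    finally show ?thesis .
  qed
  have tip: "?S j = c (n - 2)" if j: "j \<in> {n - 1, n}" for j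
  proof -
    obtain m where m: "n = m + 3" using assms(2) le_Suc_ex[of 3 n] by auto
    have "?S j = (\<Sum>i = 1..n. if i = n - 2 then c i else 0)"
      unfolding S
    proof (intro sum.cong refl if_cong)
      fix i
      have "j = m + 2 \<or> j = m + 3" using j by (auto simp: m)
      then show "(i \<noteq> j \<and> (dynkin_edge (Type_D n) i j \<or> dynkin_edge (Type_D n) j i)) = (i = n - 2)"
        if "i \<in> {1..n}"
        using that by (elim disjE) (auto simp: m)
    qed
    then show ?thesis using assms(2) by simp
  qed
  have split: "(\<forall>j\<in>{1..n}. P j) \<longleftrightarrow> (\<forall>j\<in>{1..n - 3}. P j) \<and> P (n - 2) \<and> P (n - 1) \<and> P n" for P
  proof -
    have "{1..n} = {1..n - 3} \<union> {n - 2, n - 1, n}" using assms(2) by auto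
    then show ?thesis by (simp only: ball_Un ball_simps simp_thms)
  qed
  have "?L \<longleftrightarrow> (\<forall>j\<in>{1..n - 3}. ?S j = 0) \<and> ?S (n - 2) = 0 \<and> ?S (n - 1) = 0 \<and> ?S n = 0"
    unfolding cartan_kernel_def rank_of.simps by (rule split)
  also have "(\<forall>j\<in>{1..n - 3}. ?S j = 0) \<longleftrightarrow> (\<forall>j\<in>{1..n - 3}. ?row j)"
    by (intro ball_cong refl) (simp only: row add_eq_0_iff_char_2[OF assms(1)])
  also have "?S (n - 2) = 0 \<and> ?S (n - 1) = 0 \<and> ?S n = 0 \<longleftrightarrow> ?last \<and> ?tip"
    by (simp only: last tip insertI1 insertI2 singletonI conj_absorb)
  finally show ?thesis .
qed

text \<open>The equations link positions of equal parity. Even positions are linked to position 0 and,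
  as \<open>n + 1\<close> is odd, odd positions to position \<open>n + 1\<close>; both ends carry 0.\<close>

lemma kernel_A_even:
  assumes char: "CHAR('k) = 2" and n: "even n" and c: "cartan_kernel (Type_A n) (c :: nat \<Rightarrow> 'k::field)"
  shows "\<forall>i\<in>{1..n}. c i = 0"
proof -
  let ?t = "truncate n c"
  have row: "?t (j - 1) = ?t (j + 1)" if "j \<in> {1..n}" for j
    using c that by (simp add: cartan_kernel_A[OF char])
  have ev: "2 * m \<le> n \<Longrightarrow> ?t (2 * m) = 0" for m
    by (induction m) (use row[of "2 * _ + 1"] in \<open>auto simp: truncate_def\<close>)
  have od: "2 * m \<le> n \<Longrightarrow> ?t (n + 1 - 2 * m) = 0" for m
  proof (induction m)
    case (Suc m)
    then show ?case using row[of "n - 2 * m"] by (simp add: Suc_diff_le)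
  qed (simp add: truncate_def)
  show ?thesis
  proof
    fix i assume i: "i \<in> {1..n}"
    have "?t i = 0"
    proof (cases "even i")
      case True
      then show ?thesis using ev[of "i div 2"] i by simp
    next
      case False
      then have "even (n + 1 - i)" using n i by simp
      then obtain m where "n + 1 - i = 2 * m" by (rule evenE)
      then have "i = n + 1 - 2 * m" "2 * m \<le> n" using i by auto
      then show ?thesis using od[of m] by simp
    qed
    then show "c i = 0" using i by (simp add: truncate_def)
  qed
qed

lemma two_step_descent:
  fixes t :: "nat \<Rightarrow> 'a::zero"
  assumes row: "\<And>j. 1 \<le> j \<Longrightarrow> j \<le> m \<Longrightarrow> t (j - 1) = t (j + 1)" and "t m = 0" "t (m + 1) = 0"
  shows "i \<le> m + 1 \<Longrightarrow> t i = 0"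
proof -
  have "k \<le> m \<Longrightarrow> t (m - k) = 0 \<and> t (m + 1 - k) = 0" for k
  proof (induction k)
    case (Suc k)
    then show ?case using row[of "m - k"] by (simp add: Suc_diff_le)
  qed (use assms in simp)
  from this[of "m - i"] show "i \<le> m + 1 \<Longrightarrow> t i = 0"
    using assms(3) by (cases "i = m + 1") auto
qed

lemma kernel_A_last_zero:
  assumes char: "CHAR('k) = 2" and c: "cartan_kernel (Type_A n) (c :: nat \<Rightarrow> 'k::field)" "c n = 0"
  shows "\<forall>i\<in>{1..n}. c i = 0"
proof
  fix i assume i: "i \<in> {1..n}"
  have "truncate n c i = 0"
    by (rule two_step_descent[of n])
      (use c i in \<open>auto simp: cartan_kernel_A[OF char], auto simp: truncate_def\<close>)
  then show "c i = 0" using i by (simp add: truncate_def)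
qed

lemma kernel_A_odd_exists:
  assumes char: "CHAR('k) = 2" and n: "odd n"
  shows "cartan_kernel (Type_A n) (\<lambda>i. if odd i then 1 else 0 :: 'k::field)"
  unfolding cartan_kernel_A[OF char] using n by (auto simp: truncate_def elim!: oddE)

text \<open>On the stem \<open>1, \<dots>, n - 2\<close> the even positions are linked to position 0, the odd ones to the
  branch vertex \<open>n - 2\<close>, where the equations of the two tips force 0.\<close>

lemma kernel_D_odd:
  assumes char: "CHAR('k) = 2" and n: "odd n" "n \<ge> 3"
    and c: "cartan_kernel (Type_D n) (c :: nat \<Rightarrow> 'k::field)" "c n = 0"
  shows "\<forall>i\<in>{1..n}. c i = 0"
proof -
  let ?t = "truncate n c"
  have row: "?t (j - 1) = ?t (j + 1)" if "j \<in> {1..n - 3}" for j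
    using c that by (simp add: cartan_kernel_D[OF char n(2)])
  have last: "?t (n - 3) + c (n - 1) + c n = 0" and tip: "c (n - 2) = 0"
    using c by (simp_all add: cartan_kernel_D[OF char n(2)])
  have ev: "2 * m \<le> n - 3 \<Longrightarrow> ?t (2 * m) = 0" for m
    by (induction m) (use row[of "2 * _ + 1"] in \<open>auto simp: truncate_def\<close>)
  have n3: "?t (n - 3) = 0" using ev[of "(n - 3) div 2"] n by simp
  have "n - 3 + 1 = n - 2" using n by simp
  then have n2: "?t (n - 3 + 1) = 0" using tip by (simp only: truncate_def if_cancel)
  have small: "?t i = 0" if "i \<le> n - 3 + 1" for i
    by (rule two_step_descent[where t = ?t and m = "n - 3", OF _ n3 n2 that]) (use row in auto)
  show ?thesis
  proof
    fix i assume i: "i \<in> {1..n}"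
    then consider "i \<le> n - 3 + 1" | "i = n - 1" | "i = n" by fastforce
    then show "c i = 0"
      using small[of i] i last n3 c(2) by cases (auto simp: truncate_def)
  qed
qed

lemma kernel_D_last_zero:
  assumes char: "CHAR('k) = 2" and n: "n \<ge> 3"
    and c: "cartan_kernel (Type_D n) (c :: nat \<Rightarrow> 'k::field)" "c n = 0" "c (n - 1) = 0"
  shows "\<forall>i\<in>{1..n}. c i = 0"
proof -
  let ?t = "truncate n c"
  have row: "?t (j - 1) = ?t (j + 1)" if "j \<in> {1..n - 3}" for j
    using c that by (simp add: cartan_kernel_D[OF char n])
  have n3: "?t (n - 3) = 0" and tip: "c (n - 2) = 0"
    using c by (simp_all add: cartan_kernel_D[OF char n])
  have "n - 3 + 1 = n - 2" using n by simp
  then have n2: "?t (n - 3 + 1) = 0" using tip by (simp only: truncate_def if_cancel)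
  have small: "?t i = 0" if "i \<le> n - 3 + 1" for i
    by (rule two_step_descent[where t = ?t and m = "n - 3", OF _ n3 n2 that]) (use row in auto)
  show ?thesis
  proof
    fix i assume i: "i \<in> {1..n}"
    then consider "i \<le> n - 3 + 1" | "i = n - 1" | "i = n" by fastforce
    then show "c i = 0"
      using small[of i] i c(2,3) by cases (auto simp: truncate_def)
  qed
qed

lemma kernel_D_odd_exists:
  assumes char: "CHAR('k) = 2" and n: "n \<ge> 3"
  shows "cartan_kernel (Type_D n) (\<lambda>i. if i = n - 1 \<or> i = n then 1 else 0 :: 'k::field)"
proof -
  obtain m where m: "n = m + 3" using n le_Suc_ex[of 3 n] by auto
  show ?thesis
    unfolding cartan_kernel_D[OF assms] by (auto simp: truncate_def m two_eq_0[OF char])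
qed

text \<open>The odd positions of the stem together with one of the two tips: each vertex of the diagram has an
  even number of neighbours in this set, and at the branch vertex \<open>n - 2\<close> the two neighbours are
  \<open>n - 3\<close> and the tip.\<close>

lemma kernel_D_even_exists:
  assumes char: "CHAR('k) = 2" and n: "n \<ge> 3" "even n" and k: "k = n - 1 \<or> k = n"
  shows "cartan_kernel (Type_D n)
    (\<lambda>i. if i \<le> n - 2 \<and> odd i \<or> i = k then 1 else 0 :: 'k::field)"
proof -
  let ?c = "\<lambda>i. if i \<le> n - 2 \<and> odd i \<or> i = k then 1 else 0 :: 'k"
  have "n \<ge> 4" using n by (cases "n = 3") auto
  then obtain m where m: "n = m + 4" using le_Suc_ex[of 4 n] by auto
  have t: "truncate n ?c i = (if odd i then 1 else 0)" if "i \<le> n - 2" for i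
    using that k by (cases "i = 0") (auto simp: truncate_def m)
  have "truncate n ?c (j - 1) = truncate n ?c (j + 1)" if "j \<in> {1..n - 3}" for j
    using that t[of "j - 1"] t[of "j + 1"] by (auto simp: m)
  moreover have "truncate n ?c (n - 3) + ?c (n - 1) + ?c n = 0"
  proof -
    have "truncate n ?c (n - 3) = 1" using t[of "n - 3"] n by (simp add: m)
    moreover have "?c (n - 1) + ?c n = 1" using k by (auto simp: m)
    ultimately show ?thesis using two_eq_0[OF char] by (simp add: add.assoc)
  qed
  moreover have "?c (n - 2) = 0" using n k by (auto simp: m)
  ultimately show ?thesis unfolding cartan_kernel_D[OF char n(1)] by blast
qed

lemma intervals: "{Suc 0..2} = {1, 2}" "{Suc 0..6} = {1, 2, 3, 4, 5, 6}"
  "{Suc 0..7} = {1, 2, 3, 4, 5, 6, 7}" "{Suc 0..8} = {1, 2, 3, 4, 5, 6, 7, 8}"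
  by auto

lemma kernel_E6:
  assumes "CHAR('k) = 2" "cartan_kernel Type_E6 (c :: nat \<Rightarrow> 'k::field)"
  shows "\<forall>i\<in>{1..6}. c i = 0"
  using assms(2) two_eq_0[OF assms(1)]
  by (auto simp: cartan_kernel_def intervals cartan_matrix_def e_edge_def)

lemma kernel_E7:
  assumes "CHAR('k) = 2" "cartan_kernel Type_E7 (c :: nat \<Rightarrow> 'k::field)" "c 7 = 0"
  shows "\<forall>i\<in>{1..7}. c i = 0"
  using assms(2,3) two_eq_0[OF assms(1)]
  by (auto simp: cartan_kernel_def intervals cartan_matrix_def e_edge_def)

text \<open>The vertices 2, 5 and 7 form a set that meets the neighbours of each vertex in an even number.\<close>

lemma kernel_E7_exists:
  assumes "CHAR('k) = 2"
  shows "cartan_kernel Type_E7 (\<lambda>i. if i \<in> {2, 5, 7} then 1 else 0 :: 'k::field)"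
  using two_eq_0[OF assms] add_eq_0_iff_char_2[OF assms, of "- 1" "- 1"]
  by (auto simp: cartan_kernel_def intervals cartan_matrix_def e_edge_def)

lemma kernel_E8:
  assumes "CHAR('k) = 2" "cartan_kernel Type_E8 (c :: nat \<Rightarrow> 'k::field)"
  shows "\<forall>i\<in>{1..8}. c i = 0"
  using assms(2) two_eq_0[OF assms(1)]
  by (auto simp: cartan_kernel_def intervals cartan_matrix_def e_edge_def)

lemma kernel_G2:
  assumes "CHAR('k) = 2" "cartan_kernel Type_G2 (c :: nat \<Rightarrow> 'k::field)"
  shows "\<forall>i\<in>{1..2}. c i = 0"
proof -
  have "(3 :: 'k) = 2 + 1" by simp
  then have "(3 :: 'k) = 1" using two_eq_0[OF assms(1)] by simp
  then show ?thesis
    using assms(2) two_eq_0[OF assms(1)]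
    by (simp add: cartan_kernel_def intervals cartan_matrix_def)
qed

section \<open>Odd pairings in the simply laced types\<close>

context integral_based_root_system
begin

lemma simple_inner_eq_edge:
  assumes "i \<in> {1..rank_of X}" "j \<in> {1..rank_of X}" "i \<noteq> j" "dynkin_edge X i j"
    and "\<And>i j. cartan_mult X i j = 1"
  shows "\<alpha> i \<bullet> \<alpha> i = \<alpha> j \<bullet> \<alpha> j"
  by (rule simple_inner_eq) (use assms in \<open>auto simp: cartan_matrix_def\<close>)

lemma odd_pairing_A:
  assumes X: "X = Type_A n" and n: "n > 1" and a: "a \<in> \<Phi>"
  shows "\<exists>i\<in>{1..rank_of X}. odd (pairing a i)"
proof (rule odd_pairing_simply_laced[OF _ _ a])
  fix i assume i: "i \<in> {1..rank_of X}"
  have len: "1 \<le> k \<Longrightarrow> k \<le> n \<Longrightarrow> \<alpha> k \<bullet> \<alpha> k = \<alpha> 1 \<bullet> \<alpha> 1" for k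
  proof (induction k rule: dec_induct)
    case (step m)
    then show ?case using simple_inner_eq_edge[of m "Suc m"] X by simp
  qed simp
  show "\<alpha> i \<bullet> \<alpha> i = \<alpha> 1 \<bullet> \<alpha> 1" using len[of i] i X by simp
  show "\<exists>j\<in>{1..rank_of X}. odd (cartan_matrix X i j)"
    by (rule bexI[of _ "if i = 1 then 2 else i - 1"])
      (use i X n in \<open>auto simp: cartan_matrix_def\<close>)
qed

lemma odd_pairing_D:
  assumes X: "X = Type_D n" and n: "n \<ge> 3" and a: "a \<in> \<Phi>"
  shows "\<exists>i\<in>{1..rank_of X}. odd (pairing a i)"
proof (rule odd_pairing_simply_laced[OF _ _ a])
  fix i assume i: "i \<in> {1..rank_of X}"
  have less: "1 \<le> k \<Longrightarrow> k < n \<Longrightarrow> \<alpha> k \<bullet> \<alpha> k = \<alpha> 1 \<bullet> \<alpha> 1" for k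
  proof (induction k rule: dec_induct)
    case (step m)
    then show ?case using simple_inner_eq_edge[of m "Suc m"] X by simp
  qed simp
  have "\<alpha> n \<bullet> \<alpha> n = \<alpha> 1 \<bullet> \<alpha> 1"
    using simple_inner_eq_edge[of "n - 2" n] less[of "n - 2"] X n by simp
  then show "\<alpha> i \<bullet> \<alpha> i = \<alpha> 1 \<bullet> \<alpha> 1" using less[of i] i X by (cases "i = n") auto
  show "\<exists>j\<in>{1..rank_of X}. odd (cartan_matrix X i j)"
    by (rule bexI[of _ "if i = 1 then if n = 3 then 3 else 2 else if i = n then n - 2 else i - 1"])
      (use i X n in \<open>auto simp: cartan_matrix_def\<close>)
qed

text \<open>Walking along the edges shows that all simple roots have the same length; vertex 2 hangs on
  vertex 4, the others form a path.\<close>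

lemma odd_pairing_E:
  assumes edge: "dynkin_edge X = e_edge" and mult: "\<And>i j. cartan_mult X i j = 1"
    and rank: "rank_of X \<ge> 4" and a: "a \<in> \<Phi>"
  shows "\<exists>i\<in>{1..rank_of X}. odd (pairing a i)"
proof (rule odd_pairing_simply_laced[OF _ _ a])
  fix i assume i: "i \<in> {1..rank_of X}"
  have eq: "\<alpha> i \<bullet> \<alpha> i = \<alpha> j \<bullet> \<alpha> j"
    if "i \<in> {1..rank_of X}" "j \<in> {1..rank_of X}" "i \<noteq> j" "e_edge i j" for i j
    using simple_inner_eq_edge[OF that(1,2,3)] that(4) edge mult by simp
  have from_3: "3 \<le> k \<Longrightarrow> k \<le> rank_of X \<Longrightarrow> \<alpha> k \<bullet> \<alpha> k = \<alpha> 3 \<bullet> \<alpha> 3" for k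
  proof (induction k rule: dec_induct)
    case (step m)
    then show ?case using eq[of m "Suc m"] by (simp add: e_edge_def)
  qed simp
  have "\<alpha> 1 \<bullet> \<alpha> 1 = \<alpha> 3 \<bullet> \<alpha> 3" "\<alpha> 2 \<bullet> \<alpha> 2 = \<alpha> 4 \<bullet> \<alpha> 4"
    using eq[of 1 3] eq[of 2 4] rank by (simp_all add: e_edge_def)
  moreover consider "i = 1" | "i = 2" | "i \<ge> 3" using i by fastforce
  ultimately show "\<alpha> i \<bullet> \<alpha> i = \<alpha> 3 \<bullet> \<alpha> 3" using from_3[of i] from_3[of 4] i rank by cases auto
  show "\<exists>j\<in>{1..rank_of X}. odd (cartan_matrix X i j)"
    by (rule bexI[of _ "if i = 1 then 3 else if i = 2 then 4 else if i = 3 then 1 else i - 1"])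
      (use i rank edge mult in \<open>auto simp: cartan_matrix_def e_edge_def\<close>)
qed

end

section \<open>Classical simple Lie 2-algebras\<close>

locale classical_simple_lie2_alg_closed =
  classical_simple_lie2_algebra \<Phi> X \<alpha> scaleL bracketL e h scaleG bracketG \<tau> scale bracket \<pi> sq
  for \<Phi> :: "'r::euclidean_space set" and X \<alpha>
    and scaleL :: "complex \<Rightarrow> 'l::ab_group_add \<Rightarrow> 'l" and bracketL e h
    and scaleG :: "'k::alg_closed_field \<Rightarrow> 'c::ab_group_add \<Rightarrow> 'c" and bracketG \<tau>
    and scale :: "'k \<Rightarrow> 'g::ab_group_add \<Rightarrow> 'g" and bracket \<pi> sq +
  assumes characteristic: "CHAR('k) = 2"
begin

sublocale lie2_algebra_alg_closed scale bracket sq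
  by unfold_locales (rule characteristic)

sublocale integral_based_root_system \<Phi> X \<alpha>
  by unfold_locales (use e_opposite in blast)

lemma centre_eq_0: "centre = {0}"
proof -
  have "subspace centre"
    by (auto simp: subspace_def centre_def bracket_add_left bracket_scale_left)
  moreover have "bracket x y = 0" if "y \<in> centre" for x y
    using that bracket_commute[of x y] by (simp add: centre_def)
  ultimately have "lie_ideal centre" by (auto simp: lie_ideal_def subspace_0)
  moreover have "centre \<noteq> UNIV" using non_abelian by (auto simp: centre_def)
  ultimately show ?thesis using only_trivial_ideals by blast
qed

lemma finite_index: "finite (\<Phi> <+> {1..rank_of X})"
  using finite_roots by simp

lemma z_form_basis:
  assumes "x \<in> \<Phi> <+> {1..rank_of X}"
  shows "case_sum e h x \<in> z_form"
proof -
  let ?c = "\<lambda>y. if y = x then 1 else 0 :: int"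
  have "(\<Sum>y\<in>\<Phi> <+> {1..rank_of X}. scaleL (of_int (?c y)) (case_sum e h y))
      = (\<Sum>y\<in>\<Phi> <+> {1..rank_of X}. if y = x then case_sum e h x else 0)"
    by (rule sum.cong) auto
  also have "\<dots> = case_sum e h x" using assms finite_index by simp
  finally have "case_sum e h x
      = (\<Sum>y\<in>\<Phi> <+> {1..rank_of X}. scaleL (of_int (?c y)) (case_sum e h y))" by simp
  then show ?thesis unfolding z_form_def by (intro CollectI exI[of _ ?c]) simp
qed

lemma z_form_e: "b \<in> \<Phi> \<Longrightarrow> e b \<in> z_form"
  using z_form_basis[OF InlI, of b] by simp

lemma z_form_h: "i \<in> {1..rank_of X} \<Longrightarrow> h i \<in> z_form"
  using z_form_basis[OF InrI, of i] by simp

lemma z_form_scale: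
  assumes "x \<in> z_form"
  shows "scaleL (of_int n) x \<in> z_form"
proof -
  obtain c :: "'r + nat \<Rightarrow> int" where
    "x = (\<Sum>y\<in>\<Phi> <+> {1..rank_of X}. scaleL (of_int (c y)) (case_sum e h y))"
    using assms by (auto simp: z_form_def)
  then have "scaleL (of_int n) x
      = (\<Sum>y\<in>\<Phi> <+> {1..rank_of X}. scaleL (of_int (n * c y)) (case_sum e h y))"
    by (simp add: L.scale_sum_right)
  then show ?thesis unfolding z_form_def by (intro CollectI exI[of _ "\<lambda>y. n * c y"]) simp
qed

lemma tensor_zero: "\<tau> 0 = 0"
proof (cases "z_form = {}")
  case False
  then obtain x where "x \<in> z_form" by blast
  from z_form_scale[OF this, of 0] have "0 \<in> z_form" by simp
  then show ?thesis using tensor_add[of 0 0] by simp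
next
  case True
  then show ?thesis unfolding z_form_def by blast
qed

lemma tensor_scale:
  assumes x: "x \<in> z_form"
  shows "\<tau> (scaleL (of_int n) x) = scaleG (of_int n) (\<tau> x)"
proof -
  have nat: "\<tau> (scaleL (of_nat m) x) = scaleG (of_nat m) (\<tau> x)" for m
  proof (induction m)
    case (Suc m)
    have "\<tau> (x + scaleL (of_nat m) x) = \<tau> x + \<tau> (scaleL (of_nat m) x)"
      using tensor_add[OF x z_form_scale[OF x, of "int m"]] by simp
    then show ?case using Suc by (simp add: L.scale_left_distrib G.scale_left_distrib)
  qed (simp add: tensor_zero)
  show ?thesis
  proof (cases n rule: int_cases2)
    case (nonneg m)
    then show ?thesis using nat[of m] by simp
  next
    case (nonpos m)
    let ?y = "scaleL (of_nat m) x"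
    have "?y \<in> z_form" using z_form_scale[OF x, of "int m"] by simp
    moreover have "- ?y \<in> z_form" using z_form_scale[OF x, of n] nonpos by simp
    ultimately have "\<tau> (- ?y) + \<tau> ?y = 0" using tensor_add[of "- ?y" ?y] by (simp add: tensor_zero)
    then have "\<tau> (- ?y) = - scaleG (of_nat m) (\<tau> x)"
      unfolding nat by (simp add: eq_neg_iff_add_eq_0)
    then show ?thesis using nonpos by simp
  qed
qed

lemma tensor_h_h:
  "i \<in> {1..rank_of X} \<Longrightarrow> j \<in> {1..rank_of X} \<Longrightarrow> bracketG (\<tau> (h i)) (\<tau> (h j)) = 0"
  using tensor_bracket[OF z_form_h z_form_h, of i j] h_h[of i j] by (simp add: tensor_zero)

lemma tensor_h_e:
  assumes "i \<in> {1..rank_of X}" "b \<in> \<Phi>"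
  shows "bracketG (\<tau> (h i)) (\<tau> (e b)) = scaleG (of_int (pairing b i)) (\<tau> (e b))"
proof -
  have "of_real (b \<bullet> coroot (\<alpha> i)) = (of_int (pairing b i) :: complex)"
    unfolding of_int_pairing[OF assms(2,1), symmetric] by simp
  then show ?thesis
    using tensor_bracket[OF z_form_h z_form_e, OF assms] h_e[OF assms]
    by (simp add: tensor_scale z_form_e[OF assms(2)])
qed

sublocale \<pi>: Vector_Spaces.linear scaleG scale \<pi>
  by (rule quotient_linear)

lemma tensor_e_combination_zero:
  assumes "(\<Sum>b\<in>\<Phi>. scaleG (x b) (\<tau> (e b))) = 0" "b \<in> \<Phi>"
  shows "x b = 0"
proof -
  let ?f = "\<tau> \<circ> case_sum e h"
  have inj: "inj_on (\<lambda>b. \<tau> (e b)) \<Phi>"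
  proof (rule inj_onI)
    fix a b assume "a \<in> \<Phi>" "b \<in> \<Phi>" "\<tau> (e a) = \<tau> (e b)"
    then have "Inl a = (Inl b :: 'r + nat)" by (intro inj_onD[OF tensor_inj]) (auto intro: InlI)
    then show "a = b" by simp
  qed
  have ind: "G.independent ((\<lambda>b. \<tau> (e b)) ` \<Phi>)"
    by (rule G.independent_mono[OF tensor_independent]) (force simp: image_iff)
  interpret Gc: coordinate_space scaleG ..
  have "Gc.indep_family \<Phi> (\<lambda>b. \<tau> (e b))"
    using inj ind finite_roots by (simp add: Gc.indep_family_iff)
  then show ?thesis using assms by (rule Gc.indep_familyD)
qed

text \<open>Dividing by the centre keeps the root vectors independent: if \<open>y\<close> is a central combination of them
  with coefficients \<open>x\<close>, the bracket with \<open>h i\<close> multiplies \<open>x b\<close> by the pairing of \<open>b\<close> with the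
  \<open>i\<close>-th simple coroot, which is odd for a suitable \<open>i\<close>.\<close>

lemma root_decomposition:
  assumes odd: "\<And>a. a \<in> \<Phi> \<Longrightarrow> \<exists>i\<in>{1..rank_of X}. odd (pairing a i)"
  shows "root_decomposition scale bracket sq \<Phi> {1..rank_of X} pairing
    (\<lambda>b. \<pi> (\<tau> (e b))) (\<lambda>i. \<pi> (\<tau> (h i)))"
proof unfold_locales
  show "finite \<Phi>" by (rule finite_roots)
  show "finite {1..rank_of X}" by simp
  show "bracket (\<pi> (\<tau> (h i))) (\<pi> (\<tau> (h j))) = 0"
    if "i \<in> {1..rank_of X}" "j \<in> {1..rank_of X}" for i j
    using tensor_h_h[OF that] by (simp add: \<pi>.zero flip: quotient_bracket)
  show "bracket (\<pi> (\<tau> (h i))) (\<pi> (\<tau> (e b))) = scale (of_int (pairing b i)) (\<pi> (\<tau> (e b)))"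
    if "i \<in> {1..rank_of X}" "b \<in> \<Phi>" for i b
    using tensor_h_e[OF that] by (simp add: \<pi>.scale flip: quotient_bracket)
  show "indep_family \<Phi> (\<lambda>b. \<pi> (\<tau> (e b)))"
    unfolding indep_family_def
  proof (intro allI impI ballI)
    fix x b assume x: "(\<Sum>b\<in>\<Phi>. scale (x b) (\<pi> (\<tau> (e b)))) = 0" and b: "b \<in> \<Phi>"
    let ?y = "\<Sum>b\<in>\<Phi>. scaleG (x b) (\<tau> (e b))"
    have "\<pi> ?y = 0" using x by (simp add: \<pi>.sum \<pi>.scale)
    then have y: "bracketG ?y z = 0" for z using quotient_kernel by (auto simp: G.centre_def)
    obtain i where i: "i \<in> {1..rank_of X}" "odd (pairing b i)" using odd[OF b] by blast
    have anti: "bracketG u v = - bracketG v u" for u v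
    proof -
      have "bracketG (u + v) (u + v) = 0" by (rule G.bracket_self)
      then have "bracketG u v + bracketG v u = 0"
        unfolding G.bracket_add_left G.bracket_add_right by (simp add: G.bracket_self add.commute)
      then show ?thesis by (simp add: eq_neg_iff_add_eq_0)
    qed
    interpret ad: Vector_Spaces.linear scaleG scaleG "bracketG (\<tau> (h i))"
      by unfold_locales (simp_all add: G.bracket_add_right G.bracket_scale_right)
    have "bracketG (\<tau> (h i)) ?y = 0" using y[of "\<tau> (h i)"] anti[of "\<tau> (h i)" ?y] by simp
    moreover have "bracketG (\<tau> (h i)) ?y
        = (\<Sum>b\<in>\<Phi>. scaleG (x b) (bracketG (\<tau> (h i)) (\<tau> (e b))))"
      by (simp add: ad.sum ad.scale)
    moreover have "\<dots> = (\<Sum>b\<in>\<Phi>. scaleG (x b * of_int (pairing b i)) (\<tau> (e b)))"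
      using i by (intro sum.cong) (simp_all add: tensor_h_e)
    ultimately have "x b * of_int (pairing b i) = 0"
      using tensor_e_combination_zero[of "\<lambda>b. x b * of_int (pairing b i)" b] b by simp
    then show "x b = 0" using i(2) by (simp add: of_int_char_2)
  qed
  show "span ((\<lambda>b. \<pi> (\<tau> (e b))) ` \<Phi> \<union> (\<lambda>i. \<pi> (\<tau> (h i))) ` {1..rank_of X}) = UNIV"
  proof -
    have "(\<tau> \<circ> case_sum e h) ` (\<Phi> <+> {1..rank_of X})
        = (\<lambda>b. \<tau> (e b)) ` \<Phi> \<union> (\<lambda>i. \<tau> (h i)) ` {1..rank_of X}"
      by (auto simp: Plus_def image_Un image_image)
    then have "\<pi> ` G.span ((\<lambda>b. \<tau> (e b)) ` \<Phi> \<union> (\<lambda>i. \<tau> (h i)) ` {1..rank_of X}) = UNIV"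
      using tensor_span quotient_surj by simp
    then show ?thesis by (simp add: image_Un image_image flip: \<pi>.span_image)
  qed
  show "centre = {0}" by (rule centre_eq_0)
  show "\<exists>i\<in>{1..rank_of X}. odd (pairing b i)" if "b \<in> \<Phi>" for b using odd[OF that] .
qed

text \<open>Roots are integral combinations of simple roots, so all roots vanish on an element of the Cartan
  subalgebra as soon as the simple ones do.\<close>

lemma toral_rank_eq_card_cartan:
  assumes odd: "\<And>a. a \<in> \<Phi> \<Longrightarrow> \<exists>i\<in>{1..rank_of X}. odd (pairing a i)"
    and J: "J \<subseteq> {1..rank_of X}"
    and ind: "\<And>c :: nat \<Rightarrow> 'k. (\<And>i. i \<in> {1..rank_of X} - J \<Longrightarrow> c i = 0) \<Longrightarrow> cartan_kernel X c
      \<Longrightarrow> \<forall>i\<in>J. c i = 0"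
    and dep: "\<And>k. k \<in> {1..rank_of X} - J \<Longrightarrow> \<exists>c :: nat \<Rightarrow> 'k.
      (\<forall>i\<in>{1..rank_of X} - J. c i = (if i = k then 1 else 0)) \<and> cartan_kernel X c"
  shows "toral_rank = card J"
proof -
  let ?I = "{1..rank_of X}"
  interpret root_decomposition scale bracket sq \<Phi> ?I pairing "\<lambda>b. \<pi> (\<tau> (e b))" "\<lambda>i. \<pi> (\<tau> (h i))"
    by (rule root_decomposition[OF odd])
  have kernel: "cartan_kernel X c \<longleftrightarrow> (\<forall>b\<in>\<Phi>. root_value c b = 0)" for c :: "nat \<Rightarrow> 'k"
  proof
    assume *: "\<forall>b\<in>\<Phi>. root_value c b = 0"
    show "cartan_kernel X c"
      unfolding cartan_kernel_def
    proof
      fix j assume j: "j \<in> ?I"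
      have "(\<Sum>i\<in>?I. c i * of_int (cartan_matrix X j i)) = root_value c (\<alpha> j)"
        unfolding root_value_def using j by (intro sum.cong) (simp_all add: pairing_simple)
      then show "(\<Sum>i\<in>?I. c i * of_int (cartan_matrix X j i)) = 0"
        using * simple_root[OF j] by simp
    qed
  next
    assume c: "cartan_kernel X c"
    show "\<forall>b\<in>\<Phi>. root_value c b = 0"
    proof
      fix b assume b: "b \<in> \<Phi>"
      obtain m where m: "b = (\<Sum>j\<in>?I. of_int (m j) *\<^sub>R \<alpha> j)" by (rule root_integral[OF b])
      have "root_value c b = (\<Sum>i\<in>?I. \<Sum>j\<in>?I. of_int (m j) * (c i * of_int (cartan_matrix X j i)))"
        unfolding root_value_def
        by (intro sum.cong) (simp_all add: pairing_root[OF m b] sum_distrib_left mult.left_commute)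
      also have "\<dots> = (\<Sum>j\<in>?I. of_int (m j) * (\<Sum>i\<in>?I. c i * of_int (cartan_matrix X j i)))"
        by (subst sum.swap) (simp add: sum_distrib_left)
      also have "\<dots> = 0" using c unfolding cartan_kernel_def by (intro sum.neutral) auto
      finally show "root_value c b = 0" .
    qed
  qed
  show ?thesis
  proof (rule toral_rank_eq_card[OF J])
    show "\<forall>i\<in>J. c i = 0"
      if "\<And>i. i \<in> ?I - J \<Longrightarrow> c i = 0" "\<And>b. b \<in> \<Phi> \<Longrightarrow> root_value c b = 0" for c
      using ind[OF that(1)] kernel[of c] that(2) by simp
    show "\<exists>c. (\<forall>i\<in>?I - J. c i = (if i = k then 1 else 0)) \<and> (\<forall>b\<in>\<Phi>. root_value c b = 0)"
      if "k \<in> ?I - J" for k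
      using dep[OF that] by (simp only: kernel)
  qed
qed

lemma toral_rank_eq_rank:
  assumes "\<And>a. a \<in> \<Phi> \<Longrightarrow> \<exists>i\<in>{1..rank_of X}. odd (pairing a i)"
    and "\<And>c :: nat \<Rightarrow> 'k. cartan_kernel X c \<Longrightarrow> \<forall>i\<in>{1..rank_of X}. c i = 0"
  shows "toral_rank = rank_of X"
  using toral_rank_eq_card_cartan[OF assms(1), of "{1..rank_of X}"] assms(2) by simp

lemma toral_rank_A_even:
  assumes "X = Type_A n" "n > 1" "\<not> 2 dvd (n + 1)"
  shows "toral_rank = n"
  using toral_rank_eq_rank[OF odd_pairing_A[OF assms(1,2)]] kernel_A_even[OF characteristic] assms
  by simp

lemma toral_rank_A_odd:
  assumes X: "X = Type_A n" and n: "n > 1" "2 dvd (n + 1)"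
  shows "toral_rank = n - 1"
proof -
  have I: "{1..rank_of X} - {1..n - 1} = {n}" using X n by auto
  have "toral_rank = card {1..n - 1}"
  proof (rule toral_rank_eq_card_cartan[OF odd_pairing_A[OF X n(1)]])
    show "{1..n - 1} \<subseteq> {1..rank_of X}" using X by auto
  next
    fix c :: "nat \<Rightarrow> 'k"
    assume "\<And>i. i \<in> {1..rank_of X} - {1..n - 1} \<Longrightarrow> c i = 0" "cartan_kernel X c"
    then show "\<forall>i\<in>{1..n - 1}. c i = 0"
      using kernel_A_last_zero[OF characteristic, of n c] X unfolding I by auto
  next
    fix k assume "k \<in> {1..rank_of X} - {1..n - 1}"
    then show "\<exists>c :: nat \<Rightarrow> 'k. (\<forall>i\<in>{1..rank_of X} - {1..n - 1}. c i = (if i = k then 1 else 0))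
        \<and> cartan_kernel X c"
      unfolding I using kernel_A_odd_exists[OF characteristic, of n] X n
      by (intro exI[of _ "\<lambda>i. if odd i then 1 else 0"]) auto
  qed
  then show ?thesis by simp
qed

lemma toral_rank_D_odd:
  assumes X: "X = Type_D n" and n: "n \<ge> 3" "odd n"
  shows "toral_rank = n - 1"
proof -
  have I: "{1..rank_of X} - {1..n - 1} = {n}" using X n by auto
  have "toral_rank = card {1..n - 1}"
  proof (rule toral_rank_eq_card_cartan[OF odd_pairing_D[OF X n(1)]])
    show "{1..n - 1} \<subseteq> {1..rank_of X}" using X by auto
  next
    fix c :: "nat \<Rightarrow> 'k"
    assume "\<And>i. i \<in> {1..rank_of X} - {1..n - 1} \<Longrightarrow> c i = 0" "cartan_kernel X c"
    then show "\<forall>i\<in>{1..n - 1}. c i = 0"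
      using kernel_D_odd[OF characteristic n(2,1), of c] X unfolding I by auto
  next
    fix k assume "k \<in> {1..rank_of X} - {1..n - 1}"
    then show "\<exists>c :: nat \<Rightarrow> 'k. (\<forall>i\<in>{1..rank_of X} - {1..n - 1}. c i = (if i = k then 1 else 0))
        \<and> cartan_kernel X c"
      unfolding I using kernel_D_odd_exists[OF characteristic n(1)] X
      by (intro exI[of _ "\<lambda>i. if i = n - 1 \<or> i = n then 1 else 0"]) auto
  qed
  then show ?thesis by simp
qed

lemma toral_rank_D_even:
  assumes X: "X = Type_D n" and n: "n \<ge> 3" "even n"
  shows "toral_rank = n - 2"
proof -
  have I: "{1..rank_of X} - {1..n - 2} = {n - 1, n}" using X n by auto
  have "toral_rank = card {1..n - 2}"
  proof (rule toral_rank_eq_card_cartan[OF odd_pairing_D[OF X n(1)]])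
    show "{1..n - 2} \<subseteq> {1..rank_of X}" using X by auto
  next
    fix c :: "nat \<Rightarrow> 'k"
    assume "\<And>i. i \<in> {1..rank_of X} - {1..n - 2} \<Longrightarrow> c i = 0" "cartan_kernel X c"
    then show "\<forall>i\<in>{1..n - 2}. c i = 0"
      using kernel_D_last_zero[OF characteristic n(1), of c] X unfolding I by auto
  next
    fix k assume "k \<in> {1..rank_of X} - {1..n - 2}"
    then have k: "k = n - 1 \<or> k = n" unfolding I by auto
    let ?c = "\<lambda>i. if i \<le> n - 2 \<and> odd i \<or> i = k then 1 else 0 :: 'k"
    have "cartan_kernel X ?c" using kernel_D_even_exists[OF characteristic n k] X by simp
    moreover have "\<forall>i\<in>{n - 1, n}. ?c i = (if i = k then 1 else 0)" using n by auto
    ultimately show "\<exists>c :: nat \<Rightarrow> 'k. (\<forall>i\<in>{1..rank_of X} - {1..n - 2}. c i = (if i = k then 1 else 0))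
        \<and> cartan_kernel X c"
      unfolding I by (intro exI[of _ ?c] conjI)
  qed
  then show ?thesis by simp
qed

lemma toral_rank_G2: "X = Type_G2 \<Longrightarrow> toral_rank = 2"
  using toral_rank_eq_rank[OF odd_pairing_G2] kernel_G2[OF characteristic] by simp

lemma toral_rank_E6: "X = Type_E6 \<Longrightarrow> toral_rank = 6"
  using toral_rank_eq_rank[OF odd_pairing_E] kernel_E6[OF characteristic] by (simp add: fun_eq_iff)

lemma toral_rank_E8: "X = Type_E8 \<Longrightarrow> toral_rank = 8"
  using toral_rank_eq_rank[OF odd_pairing_E] kernel_E8[OF characteristic] by (simp add: fun_eq_iff)

lemma toral_rank_E7:
  assumes X: "X = Type_E7"
  shows "toral_rank = 6"
proof -
  have I: "{1..rank_of X} - {1..6} = {7}" using X by auto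
  have "toral_rank = card {1..6::nat}"
  proof (rule toral_rank_eq_card_cartan[OF odd_pairing_E])
    show "dynkin_edge X = e_edge" using X by (simp add: fun_eq_iff)
    show "cartan_mult X i j = 1" for i j using X by simp
    show "rank_of X \<ge> 4" using X by simp
    show "{1..6} \<subseteq> {1..rank_of X}" using X by auto
  next
    fix c :: "nat \<Rightarrow> 'k"
    assume "\<And>i. i \<in> {1..rank_of X} - {1..6} \<Longrightarrow> c i = 0" "cartan_kernel X c"
    then show "\<forall>i\<in>{1..6}. c i = 0"
      using kernel_E7[OF characteristic, of c] X unfolding I by auto
  next
    fix k assume "k \<in> {1..rank_of X} - {1..6}"
    then show "\<exists>c :: nat \<Rightarrow> 'k. (\<forall>i\<in>{1..rank_of X} - {1..6}. c i = (if i = k then 1 else 0))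
        \<and> cartan_kernel X c"
      unfolding I using kernel_E7_exists[OF characteristic] X
      by (intro exI[of _ "\<lambda>i. if i \<in> {2, 5, 7} then 1 else 0"]) auto
  qed
  then show ?thesis by simp
qed

end

theorem corollary5p6:
  fixes \<Phi> :: "'r::euclidean_space set" and X :: root_type and \<alpha> :: "nat \<Rightarrow> 'r"
    and scaleL :: "complex \<Rightarrow> 'l::ab_group_add \<Rightarrow> 'l" and bracketL :: "'l \<Rightarrow> 'l \<Rightarrow> 'l"
    and e :: "'r \<Rightarrow> 'l" and h :: "nat \<Rightarrow> 'l"
    and scaleG :: "'k::alg_closed_field \<Rightarrow> 'c::ab_group_add \<Rightarrow> 'c" and bracketG :: "'c \<Rightarrow> 'c \<Rightarrow> 'c"
    and \<tau> :: "'l \<Rightarrow> 'c"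
    and scale :: "'k \<Rightarrow> 'g::ab_group_add \<Rightarrow> 'g" and bracket :: "'g \<Rightarrow> 'g \<Rightarrow> 'g"
    and \<pi> :: "'c \<Rightarrow> 'g" and sq :: "'g \<Rightarrow> 'g"
  defines "MT \<equiv> lie2_algebra.toral_rank scale bracket sq"
  assumes "CHAR('k) = 2"
    and "classical_simple_lie2_algebra \<Phi> X \<alpha> scaleL bracketL e h scaleG bracketG \<tau> scale bracket \<pi> sq"
  shows "(\<forall>n. X = Type_A n \<and> n > 1 \<and> \<not> 2 dvd (n + 1) \<longrightarrow> MT = n) \<and>
    (\<forall>n. X = Type_A n \<and> n > 1 \<and> 2 dvd (n + 1) \<longrightarrow> MT = n - 1) \<and>
    (\<forall>n. X = Type_D n \<and> n \<ge> 3 \<and> odd n \<longrightarrow> MT = n - 1) \<and>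
    (\<forall>n. X = Type_D n \<and> n \<ge> 3 \<and> even n \<longrightarrow> MT = n - 2) \<and>
    (X = Type_G2 \<longrightarrow> MT = 2) \<and>
    (X = Type_E6 \<longrightarrow> MT = 6) \<and>
    (X = Type_E7 \<longrightarrow> MT = 6) \<and>
    (X = Type_E8 \<longrightarrow> MT = 8)"
proof -
  interpret classical_simple_lie2_alg_closed \<Phi> X \<alpha> scaleL bracketL e h scaleG bracketG \<tau>
    scale bracket \<pi> sq
    using assms(2,3) by (simp add: classical_simple_lie2_alg_closed_def
        classical_simple_lie2_alg_closed_axioms_def)
  show ?thesis
    unfolding MT_def
    using toral_rank_A_even toral_rank_A_odd toral_rank_D_odd toral_rank_D_even toral_rank_G2
      toral_rank_E6 toral_rank_E7 toral_rank_E8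
    by blast
qed

end
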